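(* Let $N_0,N_B,N_f\ge1$ be integers with $N_B$ dividing $N_0$, and set $n=N_0/N_B$. Let $\Sigma_{\tilde x}\in\mathbb{R}^{N_B\times N_B}$ be positive definite, let $\Sigma_x=\mathrm{blockdiag}(\Sigma_{\tilde x},\dots,\Sigma_{\tilde x})\in\mathbb{R}^{N_0\times N_0}$ ($n$ identical blocks), let $\sigma^2>0$ and $F>0$. Let $X\sim\mathcal{N}(0;\Sigma_x)$, and for $W\in\mathbb{R}^{N_f\times N_B}$ and $b\in\mathbb{R}^{nN_f}$ let $Z\in\mathbb{R}^{nN_f}$ satisfy $Z\mid X,W,b\sim\mathcal{N}(X\circledast W+b;\,\sigma^2 I_{nN_f})$. Define $\mathrm{MMI}(X;Z)\triangleq\sup\{I_{W,b}(X;Z): W\in\mathbb{R}^{N_f\times N_B},\ b\in\mathbb{R}^{nN_f},\ \mathrm{Tr}(W^TW)\le F\}$. Then $$\mathrm{MMI}(X;Z)=\frac{N_0}{N_B}\,M_{LFC}(F;\Sigma_{\tilde x},N_B,N_f).$$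
   Context: $\mathcal{N}(\mu;A)$ denotes the Gaussian distribution with mean $\mu$ and covariance $A$. For $j=1,\dots,n$, $\tilde X_j\in\mathbb{R}^{N_B}$ is the slice of $X$ on indices $(j-1)N_B+1,\dots,jN_B$, and $X\circledast W\triangleq\begin{bmatrix}(W\tilde X_1)^T & (W\tilde X_2)^T&\cdots&(W\tilde X_n)^T\end{bmatrix}^T\in\mathbb{R}^{nN_f}$ (a non-overlapping-stride convolution with $N_f$ filters). $I_{W,b}(X;Z)$ is the mutual information between $X$ and $Z$ under the joint law determined by $W,b$. For a positive definite $\Sigma\in\mathbb{R}^{p\times p}$ and integers $p,q\ge1$, $M_{LFC}(F;\Sigma,p,q)$ denotes the maximum mutual information of the single-layer linear fully connected Gaussian model: $M_{LFC}(F;\Sigma,p,q)=\sup\{I(X';Z'): W'\in\mathbb{R}^{q\times p},\ b'\in\mathbb{R}^q,\ \mathrm{Tr}(W'^TW')\le F\}$ where $X'\sim\mathcal{N}(0;\Sigma)$ and $Z'\mid X'\sim\mathcal{N}(W'X'+b';\sigma^2 I_q)$ (its value is given explicitly by the water-filling formulas: with $\lambda_1\ge\dots\ge\lambda_p$ the eigenvalues of $\Sigma$, $\tilde N=\min(p,q)$, $\rho_k=\sigma^2(k/\lambda_k-\sum_{i\le k}1/\lambda_i)$, and $m$ the largest $k\le\tilde N$ with $\rho_k\le F$, it equals $\frac m2\log\frac{F+\sigma^2\sum_{i\le m}1/\lambda_i}{\sigma^2 m}+\frac12\sum_{i\le m}\log\lambda_i$). *)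

theory Defs
  imports "HOL-Probability.Probability" "Jordan_Normal_Form.Determinant"
    "Jordan_Normal_Form.Gauss_Jordan_Elimination"
begin

(* Matrices/vectors: Jordan_Normal_Form 'real mat' / 'real vec' (dimensions are runtime values).
   Random vectors in R^d live in the measure space PiM {..<d} (\<lambda>_. lborel) on nat \<Rightarrow> real;
   vec d x converts such a point to a 'real vec'. Indices are 0-based. *)

definition Rspace :: "nat \<Rightarrow> (nat \<Rightarrow> real) measure" where
  "Rspace d = PiM {..<d} (\<lambda>_. lborel)"

definition mat_trace :: "real mat \<Rightarrow> real" where
  "mat_trace A = (\<Sum>i<dim_row A. A $$ (i, i))"

definition pos_def :: "nat \<Rightarrow> real mat \<Rightarrow> bool" where
  "pos_def d S \<longleftrightarrow> S \<in> carrier_mat d d \<and> transpose_mat S = S \<and>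
     (\<forall>v \<in> carrier_vec d. v \<noteq> 0\<^sub>v d \<longrightarrow> v \<bullet> (S *\<^sub>v v) > 0)"

definition mat_inv :: "real mat \<Rightarrow> real mat" where
  "mat_inv S = the (mat_inverse S)"

definition gauss_density :: "nat \<Rightarrow> real vec \<Rightarrow> real mat \<Rightarrow> (nat \<Rightarrow> real) \<Rightarrow> real" where
  "gauss_density d mu S x =
     exp (- (1/2) * ((vec d x - mu) \<bullet> (mat_inv S *\<^sub>v (vec d x - mu))))
       / sqrt ((2 * pi) ^ d * det S)"

definition gauss_channel_joint ::
  "nat \<Rightarrow> nat \<Rightarrow> real mat \<Rightarrow> real \<Rightarrow> (real vec \<Rightarrow> real vec)
     \<Rightarrow> ((nat \<Rightarrow> real) \<times> (nat \<Rightarrow> real)) measure" where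
  "gauss_channel_joint p q S sigma2 f =
     density (Rspace p \<Otimes>\<^sub>M Rspace q)
       (\<lambda>(x, z). ennreal (gauss_density p (0\<^sub>v p) S x *
                          gauss_density q (f (vec p x)) (sigma2 \<cdot>\<^sub>m 1\<^sub>m q) z))"

definition gauss_channel_MI ::
  "nat \<Rightarrow> nat \<Rightarrow> real mat \<Rightarrow> real \<Rightarrow> (real vec \<Rightarrow> real vec) \<Rightarrow> real" where
  "gauss_channel_MI p q S sigma2 f =
     prob_space.mutual_information (gauss_channel_joint p q S sigma2 f) (exp 1)
       (Rspace p) (Rspace q) fst snd"

definition M_LFC :: "real \<Rightarrow> real \<Rightarrow> real mat \<Rightarrow> nat \<Rightarrow> nat \<Rightarrow> real" where
  "M_LFC sigma2 F S p q =
     Sup {gauss_channel_MI p q S sigma2 (\<lambda>x. W' *\<^sub>v x + b') | W' b'.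
            W' \<in> carrier_mat q p \<and> b' \<in> carrier_vec q \<and>
            mat_trace (transpose_mat W' * W') \<le> F}"

definition slice :: "nat \<Rightarrow> real vec \<Rightarrow> nat \<Rightarrow> real vec" where
  "slice NB X j = vec NB (\<lambda>l. X $ (j * NB + l))"

definition conv_stride :: "nat \<Rightarrow> nat \<Rightarrow> nat \<Rightarrow> real vec \<Rightarrow> real mat \<Rightarrow> real vec" where
  "conv_stride NB Nf n X W = vec (n * Nf) (\<lambda>i. (W *\<^sub>v slice NB X (i div Nf)) $ (i mod Nf))"

definition blockdiag_rep :: "nat \<Rightarrow> nat \<Rightarrow> real mat \<Rightarrow> real mat" where
  "blockdiag_rep NB n S = mat (n * NB) (n * NB)
     (\<lambda>(i, j). if i div NB = j div NB then S $$ (i mod NB, j mod NB) else 0)"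

definition MMI_conv :: "nat \<Rightarrow> nat \<Rightarrow> nat \<Rightarrow> real mat \<Rightarrow> real \<Rightarrow> real \<Rightarrow> real" where
  "MMI_conv N0 NB Nf St sigma2 F =
     (let n = N0 div NB in
      Sup {gauss_channel_MI N0 (n * Nf) (blockdiag_rep NB n St) sigma2
              (\<lambda>x. conv_stride NB Nf n x W + b) | W b.
            W \<in> carrier_mat Nf NB \<and> b \<in> carrier_vec (n * Nf) \<and>
            mat_trace (transpose_mat W * W) \<le> F})"

end

theory Submission
  imports Defs
begin

text \<open>For a channel with source density \<open>f\<close>, noise kernel \<open>g\<close> and output density \<open>h\<close>, the mutual
  information is the expectation of \<open>ln (g x z / h z)\<close> under the joint law. For the convolution the
  source and the noise both factor over the \<open>n\<close> blocks, hence so does \<open>h\<close>, and the information of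
  \<open>(W, b)\<close> is the sum over the blocks \<open>j\<close> of the information of the fully connected channels
  \<open>(W, b\<^sub>j)\<close>, where \<open>b\<^sub>j\<close> is the \<open>j\<close>-th slice of \<open>b\<close>. Choosing all \<open>b\<^sub>j\<close> equal, the supremum of these
  sums is \<open>n\<close> times the fully connected supremum. Since \<open>Sup\<close> on the reals is unspecified for unbounded
  sets, and additivity of the expectation needs integrability, one also has to bound the information
  density: \<open>g\<close> is bounded above, and \<open>h\<close> is bounded below by a Gaussian profile, uniformly in \<open>W\<close> and
  \<open>b\<close> under the trace constraint, so finite second moments suffice.\<close>


unbundle no vec_syntax and no inner_syntax

section \<open>Channels with densities\<close>

text \<open>Strict positivity everywhere keeps all quotients and logarithms meaningful without
  null-set arguments. The uniform bound \<open>G\<close> makes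
  \<open>\<lambda>x. f x * g x z\<close> integrable for every single \<open>z\<close>, and later
  bounds the output density from above.\<close>

locale density_channel =
  A: sigma_finite_measure A + B: sigma_finite_measure B
  for A :: "'a measure" and B :: "'b measure" +
  fixes f :: "'a \<Rightarrow> real" and g :: "'a \<Rightarrow> 'b \<Rightarrow> real" and G :: real
  assumes f_measurable [measurable]: "f \<in> borel_measurable A"
    and g_measurable [measurable]: "(\<lambda>(x, z). g x z) \<in> borel_measurable (A \<Otimes>\<^sub>M B)"
    and f_pos: "0 < f x" and g_pos: "0 < g x z" and g_le: "g x z \<le> G"
    and nn_integral_f: "(\<integral>\<^sup>+x. f x \<partial>A) = 1"
    and nn_integral_g: "x \<in> space A \<Longrightarrow> (\<integral>\<^sup>+z. g x z \<partial>B) = 1"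
begin

definition "joint = density (A \<Otimes>\<^sub>M B) (\<lambda>(x, z). ennreal (f x * g x z))"

text \<open>A Bochner integral, so that the output density is real-valued and can stand under
  \<open>ln\<close>; \<open>nn_integral_out\<close> links it to the nonnegative integral that
  Tonelli produces.\<close>

definition "out z = (\<integral>x. f x * g x z \<partial>A)"

definition "info = (\<lambda>(x, z). ln (g x z / out z))"

lemma f_nonneg: "0 \<le> f x" and g_nonneg: "0 \<le> g x z"
  using f_pos[of x] g_pos[of x z] by simp_all

lemma out_measurable [measurable]: "out \<in> borel_measurable B"
  unfolding out_def by measurable

lemma info_measurable [measurable]: "info \<in> borel_measurable (A \<Otimes>\<^sub>M B)"
  unfolding info_def by measurable

lemma sets_joint [simp, measurable_cong]: "sets joint = sets (A \<Otimes>\<^sub>M B)"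
  and space_joint [simp]: "space joint = space A \<times> space B"
  by (simp_all add: joint_def space_pair_measure)

text \<open>Tonelli, with the source density pulled out of the inner integral: the joint law is
  integrated by averaging over the noise at fixed input and then over the input.\<close>

lemma nn_integral_joint:
  fixes \<phi> :: "'a \<times> 'b \<Rightarrow> ennreal"
  assumes [measurable]: "\<phi> \<in> borel_measurable (A \<Otimes>\<^sub>M B)"
  shows "(\<integral>\<^sup>+y. \<phi> y \<partial>joint) = (\<integral>\<^sup>+x. f x * (\<integral>\<^sup>+z. g x z * \<phi> (x, z) \<partial>B) \<partial>A)"
proof -
  have "(\<integral>\<^sup>+y. \<phi> y \<partial>joint) = (\<integral>\<^sup>+x. \<integral>\<^sup>+z. f x * g x z * \<phi> (x, z) \<partial>B \<partial>A)"
    unfolding joint_def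
    by (subst nn_integral_density; simp add: B.nn_integral_fst[symmetric] split_beta')
  also have "\<dots> = (\<integral>\<^sup>+x. f x * (\<integral>\<^sup>+z. g x z * \<phi> (x, z) \<partial>B) \<partial>A)"
    by (intro nn_integral_cong, subst nn_integral_cmult[symmetric])
      (auto simp: ennreal_mult f_nonneg g_nonneg mult.assoc)
  finally show ?thesis .
qed

lemma prob_space_joint: "prob_space joint"
proof
  have "emeasure joint (space joint) = (\<integral>\<^sup>+y. 1 \<partial>joint)" by simp
  also have "\<dots> = (\<integral>\<^sup>+x. f x * (\<integral>\<^sup>+z. ennreal (g x z) * 1 \<partial>B) \<partial>A)"
    by (rule nn_integral_joint) measurable
  also have "\<dots> = 1"
    by (simp add: nn_integral_f nn_integral_g cong: nn_integral_cong)
  finally show "emeasure joint (space joint) = 1" .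
qed

lemma integrable_f: "integrable A f"
  by (rule integrableI_nonneg) (auto simp: f_nonneg nn_integral_f)

lemma integrable_fg: "z \<in> space B \<Longrightarrow> integrable A (\<lambda>x. f x * g x z)"
proof (rule Bochner_Integration.integrable_bound[OF integrable_mult_left[OF integrable_f, of G]])
  have "norm (f x * g x z) \<le> norm (f x * G)" for x
    using g_le[of x z] g_nonneg[of x z] f_nonneg[of x] by (simp add: abs_mult mult_left_mono)
  then show "AE x in A. norm (f x * g x z) \<le> norm (f x * G)" by simp
qed auto

lemma nn_integral_out: "z \<in> space B \<Longrightarrow> (\<integral>\<^sup>+x. f x * g x z \<partial>A) = out z"
  unfolding out_def by (intro nn_integral_eq_integral integrable_fg) (auto simp: f_nonneg g_nonneg)

text \<open>The source density has total mass one, so \<open>A\<close> is not the null measure. This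
  is what makes integrals of strictly positive functions strictly positive.\<close>

lemma not_AE_False: "\<not> (AE x in A. False)"
proof
  assume "AE x in A. False"
  then have "AE x in A. ennreal (f x) = 0" by auto
  then show False using nn_integral_f by (subst (asm) nn_integral_0_iff_AE[symmetric]) auto
qed

lemma integral_pos:
  fixes u :: "'a \<Rightarrow> real"
  assumes "\<And>x. 0 < u x" "integrable A u" shows "0 < (\<integral>x. u x \<partial>A)"
proof -
  have "(\<integral>x. u x \<partial>A) \<noteq> 0"
  proof
    assume "(\<integral>x. u x \<partial>A) = 0"
    then have "AE x in A. u x = 0"
      using integral_nonneg_eq_0_iff_AE[OF assms(2)] assms(1) by (simp add: less_imp_le)
    with assms(1) have "AE x in A. False" by (auto simp: less_le)
    with not_AE_False show False by blast
  qed
  moreover have "0 \<le> (\<integral>x. u x \<partial>A)" using assms by (intro integral_nonneg_AE AE_I2 less_imp_le)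
  ultimately show ?thesis by simp
qed

lemma out_pos: "z \<in> space B \<Longrightarrow> 0 < out z"
  unfolding out_def by (intro integral_pos integrable_fg) (auto simp: f_pos g_pos)

lemma out_le: "z \<in> space B \<Longrightarrow> out z \<le> G"
proof -
  assume "z \<in> space B"
  then have "out z \<le> (\<integral>x. f x * G \<partial>A)" unfolding out_def
    by (intro integral_mono integrable_fg integrable_mult_left integrable_f mult_left_mono g_le f_nonneg)
  also have "\<dots> = G" using nn_integral_f integral_eq_nn_integral[of f A] by (auto simp: f_nonneg)
  finally show ?thesis .
qed

text \<open>The marginals of the joint law have densities \<open>f\<close> and \<open>out\<close>,
  so the general formula has the logarithm of \<open>f x * g x z / (f x * out z)\<close> as its
  integrand, where the positive factor \<open>f x\<close> cancels.\<close>

lemma mutual_information_joint: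
  "prob_space.mutual_information joint (exp 1) A B fst snd = (\<integral>y. info y \<partial>joint)"
proof -
  interpret J: prob_space joint by (rule prob_space_joint)
  interpret J: information_space joint "exp 1" by unfold_locales simp
  interpret AB: pair_sigma_finite A B ..
  have X: "distributed joint A fst f" unfolding distributed_def
  proof (intro conjI measure_eqI)
    fix X assume "X \<in> sets (distr joint A fst)" 
    then have X [measurable]: "X \<in> sets A" by simp
    have "emeasure (distr joint A fst) X = (\<integral>\<^sup>+y. indicator X (fst y) \<partial>joint)"
      by (subst nn_integral_indicator[symmetric], simp, subst nn_integral_distr) auto
    also have "\<dots> = (\<integral>\<^sup>+x. ennreal (f x) * indicator X x \<partial>A)"
      by (subst nn_integral_joint) (auto simp: nn_integral_multc nn_integral_g cong: nn_integral_cong)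
    finally show "emeasure (distr joint A fst) X = emeasure (density A (\<lambda>x. ennreal (f x))) X"
      by (simp add: emeasure_density)
  qed (auto simp: f_nonneg)
  have Z: "distributed joint B snd out" unfolding distributed_def
  proof (intro conjI measure_eqI)
    fix X assume "X \<in> sets (distr joint B snd)" 
    then have X [measurable]: "X \<in> sets B" by simp
    have "emeasure (distr joint B snd) X = (\<integral>\<^sup>+y. indicator X (snd y) \<partial>joint)"
      by (subst nn_integral_indicator[symmetric], simp, subst nn_integral_distr) auto
    also have "\<dots> = (\<integral>\<^sup>+x. \<integral>\<^sup>+z. ennreal (f x * g x z) * indicator X z \<partial>B \<partial>A)"
      by (subst nn_integral_joint, simp, intro nn_integral_cong, subst nn_integral_cmult[symmetric])
        (auto simp: ennreal_mult f_nonneg g_nonneg mult.assoc)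
    also have "\<dots> = (\<integral>\<^sup>+z. \<integral>\<^sup>+x. ennreal (f x * g x z) * indicator X z \<partial>A \<partial>B)"
      by (rule AB.Fubini'[symmetric]) measurable
    also have "\<dots> = (\<integral>\<^sup>+z. ennreal (out z) * indicator X z \<partial>B)"
      by (intro nn_integral_cong, subst nn_integral_multc) (auto simp: nn_integral_out)
    finally show "emeasure (distr joint B snd) X = emeasure (density B (\<lambda>x. ennreal (out x))) X"
      by (simp add: emeasure_density)
  qed auto
  have XZ: "distributed joint (A \<Otimes>\<^sub>M B) (\<lambda>x. (fst x, snd x)) (\<lambda>(x, z). f x * g x z)"
    unfolding distributed_def by (simp add: joint_def split_beta' distr_id2)
  have "prob_space.mutual_information joint (exp 1) A B fst snd =
     (\<integral>y. (case y of (x, z) \<Rightarrow> f x * g x z) * log (exp 1) ((case y of (x, z) \<Rightarrow> f x * g x z) / (f (fst y) * out (snd y))) \<partial>(A \<Otimes>\<^sub>M B))"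
    by (rule J.mutual_information_distr[OF _ _ X _ Z _ XZ])
      (auto simp: A.sigma_finite_measure_axioms B.sigma_finite_measure_axioms f_nonneg g_nonneg out_pos less_imp_le)
  also have "\<dots> = (\<integral>y. (case y of (x, z) \<Rightarrow> f x * g x z) * info y \<partial>(A \<Otimes>\<^sub>M B))"
    using f_pos by (intro Bochner_Integration.integral_cong) (auto simp: info_def log_def less_imp_neq[symmetric])
  also have "\<dots> = (\<integral>y. info y \<partial>joint)"
    unfolding joint_def by (subst integral_real_density[symmetric]) (auto simp: f_nonneg g_nonneg split_beta')
  finally show ?thesis .
qed

end

text \<open>Densities of independent channels multiply, so their information densities add; each
  summand depends on one factor only and is integrated against that marginal of the joint law. The
  product structure enters through integrals of \<open>\<phi> (\<pi>1 x) * \<psi> (\<pi>2 x)\<close>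
  instead of a product measure, so that it applies directly to coordinate blocks of one function
  space.\<close>

lemma density_channel_product:
  fixes A :: "'a measure" and B :: "'b measure" and A1 :: "'c measure" and A2 :: "'d measure"
    and B1 :: "'e measure" and B2 :: "'f measure"
  assumes "density_channel A B f g G" "density_channel A1 B1 f1 g1 G1" "density_channel A2 B2 f2 g2 G2"
    and [measurable]: "\<pi>1 \<in> measurable A A1" "\<pi>2 \<in> measurable A A2"
      "\<rho>1 \<in> measurable B B1" "\<rho>2 \<in> measurable B B2"
    and A_prod: "\<And>(\<phi> :: _ \<Rightarrow> ennreal) (\<psi> :: _ \<Rightarrow> ennreal). \<phi> \<in> borel_measurable A1 \<Longrightarrow> \<psi> \<in> borel_measurable A2 \<Longrightarrow>
      (\<integral>\<^sup>+x. \<phi> (\<pi>1 x) * \<psi> (\<pi>2 x) \<partial>A) = (\<integral>\<^sup>+x. \<phi> x \<partial>A1) * (\<integral>\<^sup>+x. \<psi> x \<partial>A2)"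
    and B_prod: "\<And>(\<phi> :: _ \<Rightarrow> ennreal) (\<psi> :: _ \<Rightarrow> ennreal). \<phi> \<in> borel_measurable B1 \<Longrightarrow> \<psi> \<in> borel_measurable B2 \<Longrightarrow>
      (\<integral>\<^sup>+z. \<phi> (\<rho>1 z) * \<psi> (\<rho>2 z) \<partial>B) = (\<integral>\<^sup>+z. \<phi> z \<partial>B1) * (\<integral>\<^sup>+z. \<psi> z \<partial>B2)"
    and f_prod: "\<And>x. x \<in> space A \<Longrightarrow> f x = f1 (\<pi>1 x) * f2 (\<pi>2 x)"
    and g_prod: "\<And>x z. x \<in> space A \<Longrightarrow> z \<in> space B \<Longrightarrow> g x z = g1 (\<pi>1 x) (\<rho>1 z) * g2 (\<pi>2 x) (\<rho>2 z)"
    and int1: "integrable (density_channel.joint A1 B1 f1 g1) (density_channel.info A1 f1 g1)"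
    and int2: "integrable (density_channel.joint A2 B2 f2 g2) (density_channel.info A2 f2 g2)"
  shows "integrable (density_channel.joint A B f g) (density_channel.info A f g)" (is ?int)
    and "(\<integral>y. density_channel.info A f g y \<partial>density_channel.joint A B f g) =
      (\<integral>y. density_channel.info A1 f1 g1 y \<partial>density_channel.joint A1 B1 f1 g1) +
      (\<integral>y. density_channel.info A2 f2 g2 y \<partial>density_channel.joint A2 B2 f2 g2)" (is ?eq)
proof -
  interpret C: density_channel A B f g G by fact
  interpret C1: density_channel A1 B1 f1 g1 G1 by fact
  interpret C2: density_channel A2 B2 f2 g2 G2 by fact
  have sp [simp]: "\<pi>1 x \<in> space A1" "\<pi>2 x \<in> space A2" if "x \<in> space A" for x
    using that by (auto intro: measurable_space)
  have sp' [simp]: "\<rho>1 z \<in> space B1" "\<rho>2 z \<in> space B2" if "z \<in> space B" for z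
    using that by (auto intro: measurable_space)
  define T1 where "T1 = (\<lambda>(x, z). (\<pi>1 x, \<rho>1 z))"
  define T2 where "T2 = (\<lambda>(x, z). (\<pi>2 x, \<rho>2 z))"
  have [measurable]: "T1 \<in> measurable (A \<Otimes>\<^sub>M B) (A1 \<Otimes>\<^sub>M B1)" "T2 \<in> measurable (A \<Otimes>\<^sub>M B) (A2 \<Otimes>\<^sub>M B2)"
    unfolding T1_def T2_def by measurable
  \<comment> \<open>Under the joint law, \<open>T1\<close> and \<open>T2\<close> are independent:
    the factorization is applied to the noise for fixed input and then to the source.\<close>
  have joint_prod: "(\<integral>\<^sup>+y. \<phi> (T1 y) * \<psi> (T2 y) \<partial>C.joint) = (\<integral>\<^sup>+y. \<phi> y \<partial>C1.joint) * (\<integral>\<^sup>+y. \<psi> y \<partial>C2.joint)"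
    if [measurable]: "\<phi> \<in> borel_measurable (A1 \<Otimes>\<^sub>M B1)" "\<psi> \<in> borel_measurable (A2 \<Otimes>\<^sub>M B2)"
    for \<phi> :: "_ \<Rightarrow> ennreal" and \<psi> :: "_ \<Rightarrow> ennreal"
  proof -
    have "(\<integral>\<^sup>+y. \<phi> (T1 y) * \<psi> (T2 y) \<partial>C.joint) =
        (\<integral>\<^sup>+x. f x * (\<integral>\<^sup>+z. g x z * (\<phi> (T1 (x, z)) * \<psi> (T2 (x, z))) \<partial>B) \<partial>A)"
      by (rule C.nn_integral_joint) measurable
    also have "\<dots> =
        (\<integral>\<^sup>+x. (f1 (\<pi>1 x) * (\<integral>\<^sup>+z. g1 (\<pi>1 x) z * \<phi> (\<pi>1 x, z) \<partial>B1)) *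
              (f2 (\<pi>2 x) * (\<integral>\<^sup>+z. g2 (\<pi>2 x) z * \<psi> (\<pi>2 x, z) \<partial>B2)) \<partial>A)"
    proof (rule nn_integral_cong)
      fix x assume x [simp]: "x \<in> space A"
      have "(\<integral>\<^sup>+z. g x z * (\<phi> (T1 (x, z)) * \<psi> (T2 (x, z))) \<partial>B) =
        (\<integral>\<^sup>+z. (\<lambda>z. g1 (\<pi>1 x) z * \<phi> (\<pi>1 x, z)) (\<rho>1 z) * (\<lambda>z. g2 (\<pi>2 x) z * \<psi> (\<pi>2 x, z)) (\<rho>2 z) \<partial>B)"
        by (intro nn_integral_cong)
          (simp add: g_prod T1_def T2_def ennreal_mult C1.g_nonneg C2.g_nonneg mult_ac)
      also have "\<dots> = (\<integral>\<^sup>+z. g1 (\<pi>1 x) z * \<phi> (\<pi>1 x, z) \<partial>B1) * (\<integral>\<^sup>+z. g2 (\<pi>2 x) z * \<psi> (\<pi>2 x, z) \<partial>B2)"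
        by (rule B_prod) measurable
      finally show "ennreal (f x) * (\<integral>\<^sup>+z. g x z * (\<phi> (T1 (x, z)) * \<psi> (T2 (x, z))) \<partial>B) =
        (f1 (\<pi>1 x) * (\<integral>\<^sup>+z. g1 (\<pi>1 x) z * \<phi> (\<pi>1 x, z) \<partial>B1)) *
              (f2 (\<pi>2 x) * (\<integral>\<^sup>+z. g2 (\<pi>2 x) z * \<psi> (\<pi>2 x, z) \<partial>B2))"
        by (simp add: f_prod ennreal_mult C1.f_nonneg C2.f_nonneg mult_ac)
    qed
    also have "\<dots> = (\<integral>\<^sup>+y. \<phi> y \<partial>C1.joint) * (\<integral>\<^sup>+y. \<psi> y \<partial>C2.joint)"
      by (subst A_prod) (auto simp: C1.nn_integral_joint C2.nn_integral_joint)
    finally show ?thesis .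
  qed
  have total1: "(\<integral>\<^sup>+y. 1 \<partial>C1.joint) = 1" and total2: "(\<integral>\<^sup>+y. 1 \<partial>C2.joint) = 1"
    by (simp_all add: prob_space.emeasure_space_1[OF C1.prob_space_joint]
        prob_space.emeasure_space_1[OF C2.prob_space_joint] del: C1.space_joint C2.space_joint)
  \<comment> \<open>Taking an indicator in one factor and the constant 1 in the other identifies the
    marginals.\<close>
  have D1: "distr C.joint (A1 \<Otimes>\<^sub>M B1) T1 = C1.joint"
  proof (rule measure_eqI)
    fix X assume "X \<in> sets (distr C.joint (A1 \<Otimes>\<^sub>M B1) T1)"
    then have [measurable]: "X \<in> sets (A1 \<Otimes>\<^sub>M B1)" by simp
    have "emeasure (distr C.joint (A1 \<Otimes>\<^sub>M B1) T1) X = (\<integral>\<^sup>+y. indicator X (T1 y) * 1 \<partial>C.joint)"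
      by (subst nn_integral_indicator[symmetric], simp, subst nn_integral_distr) auto
    also have "\<dots> = emeasure C1.joint X"
      by (subst joint_prod) (simp_all only: total2, auto)
    finally show "emeasure (distr C.joint (A1 \<Otimes>\<^sub>M B1) T1) X = emeasure C1.joint X" .
  qed simp
  have D2: "distr C.joint (A2 \<Otimes>\<^sub>M B2) T2 = C2.joint"
  proof (rule measure_eqI)
    fix X assume "X \<in> sets (distr C.joint (A2 \<Otimes>\<^sub>M B2) T2)"
    then have [measurable]: "X \<in> sets (A2 \<Otimes>\<^sub>M B2)" by simp
    have "emeasure (distr C.joint (A2 \<Otimes>\<^sub>M B2) T2) X = (\<integral>\<^sup>+y. 1 * indicator X (T2 y) \<partial>C.joint)"
      by (subst nn_integral_indicator[symmetric], simp, subst nn_integral_distr) auto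
    also have "\<dots> = emeasure C2.joint X"
      by (subst joint_prod) (simp_all only: total1, auto)
    finally show "emeasure (distr C.joint (A2 \<Otimes>\<^sub>M B2) T2) X = emeasure C2.joint X" .
  qed simp
  \<comment> \<open>At fixed \<open>z\<close> the integrand splits over the two source blocks. The
    equation is derived in \<open>ennreal\<close> and descends to the reals by positivity.\<close>
  have out_prod: "C.out z = C1.out (\<rho>1 z) * C2.out (\<rho>2 z)" if z [simp]: "z \<in> space B" for z
  proof -
    have "ennreal (C.out z) =
      (\<integral>\<^sup>+x. (\<lambda>x. ennreal (f1 x * g1 x (\<rho>1 z))) (\<pi>1 x) * (\<lambda>x. ennreal (f2 x * g2 x (\<rho>2 z))) (\<pi>2 x) \<partial>A)"
      unfolding C.nn_integral_out[OF z, symmetric]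
      by (intro nn_integral_cong)
        (simp add: f_prod g_prod ennreal_mult C1.f_nonneg C2.f_nonneg C1.g_nonneg C2.g_nonneg mult_ac)
    also have "\<dots> = ennreal (C1.out (\<rho>1 z)) * ennreal (C2.out (\<rho>2 z))"
      by (subst A_prod) (simp_all add: C1.nn_integral_out C2.nn_integral_out)
    also have "\<dots> = ennreal (C1.out (\<rho>1 z) * C2.out (\<rho>2 z))"
      by (simp add: ennreal_mult C1.out_pos C2.out_pos less_imp_le)
    finally show ?thesis
      using C.out_pos[OF z] C1.out_pos[OF sp'(1)[OF z]] C2.out_pos[OF sp'(2)[OF z]] by simp
  qed
  have info: "C.info y = C1.info (T1 y) + C2.info (T2 y)" if "y \<in> space C.joint" for y
  proof -
    obtain x z where y: "y = (x, z)" "x \<in> space A" "z \<in> space B" using \<open>y \<in> _\<close> by auto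
    have "0 < g1 (\<pi>1 x) (\<rho>1 z) / C1.out (\<rho>1 z)" "0 < g2 (\<pi>2 x) (\<rho>2 z) / C2.out (\<rho>2 z)"
      using y by (simp_all add: C1.out_pos C2.out_pos C1.g_pos C2.g_pos)
    from ln_mult_pos[OF this] y show ?thesis
      by (simp add: C.info_def C1.info_def C2.info_def T1_def T2_def g_prod out_prod)
  qed
  have i1: "integrable C.joint (\<lambda>y. C1.info (T1 y))" and i2: "integrable C.joint (\<lambda>y. C2.info (T2 y))"
    using int1 int2 by (auto simp: D1[symmetric] D2[symmetric] integrable_distr_eq)
  have e1: "(\<integral>y. C1.info (T1 y) \<partial>C.joint) = (\<integral>y. C1.info y \<partial>C1.joint)"
    unfolding D1[symmetric] by (subst integral_distr) auto
  have e2: "(\<integral>y. C2.info (T2 y) \<partial>C.joint) = (\<integral>y. C2.info y \<partial>C2.joint)"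
    unfolding D2[symmetric] by (subst integral_distr) auto
  show ?int
    using Bochner_Integration.integrable_add[OF i1 i2] info by (subst Bochner_Integration.integrable_cong[OF refl info])
  show ?eq
    unfolding e1[symmetric] e2[symmetric] Bochner_Integration.integral_add[OF i1 i2, symmetric]
    using info by (intro Bochner_Integration.integral_cong refl)
qed

section \<open>Gaussian integrals\<close>

text \<open>Takes points of \<open>Rspace d\<close> as they are, so that measurability and
  integration coordinate by coordinate need no detour through vectors. Only the coordinates below
  \<open>d\<close> matter.\<close>

definition quad_form :: "nat \<Rightarrow> real mat \<Rightarrow> (nat \<Rightarrow> real) \<Rightarrow> real" where
  "quad_form d P x = (\<Sum>i<d. \<Sum>j<d. P $$ (i, j) * x i * x j)"

lemma scalar_prod_mult_mat_vec_eq_quad_form: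
  assumes "P \<in> carrier_mat d d" "v \<in> carrier_vec d"
  shows "v \<bullet> (P *\<^sub>v v) = quad_form d P (\<lambda>i. v $ i)"
  using assms
  by (auto simp: scalar_prod_def quad_form_def lessThan_atLeast0 sum_distrib_left mult_ac intro!: sum.cong)

lemma pos_def_iff_quad_form:
  "pos_def d P \<longleftrightarrow> P \<in> carrier_mat d d \<and> (\<forall>i<d. \<forall>j<d. P $$ (i, j) = P $$ (j, i)) \<and>
     (\<forall>x. (\<exists>i<d. x i \<noteq> 0) \<longrightarrow> 0 < quad_form d P x)"
  (is "?l \<longleftrightarrow> ?r")
proof
  assume l: ?l
  then have P: "P \<in> carrier_mat d d" and T: "P\<^sup>T = P" by (auto simp: pos_def_def)
  have "P $$ (i, j) = P $$ (j, i)" if "i < d" "j < d" for i j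
    using arg_cong[OF T, of "\<lambda>M. M $$ (j, i)"] P that by simp
  moreover have "0 < quad_form d P x" if "\<exists>i<d. x i \<noteq> 0" for x
  proof -
    have "vec d x \<noteq> 0\<^sub>v d" using that by (metis index_vec index_zero_vec(1))
    then have "0 < vec d x \<bullet> (P *\<^sub>v vec d x)" using l by (auto simp: pos_def_def)
    then show ?thesis using P by (simp add: scalar_prod_mult_mat_vec_eq_quad_form quad_form_def)
  qed
  ultimately show ?r using P by blast
next
  assume r: ?r
  then have P: "P \<in> carrier_mat d d" by blast
  have "P\<^sup>T = P" using r by (intro eq_matI) auto
  moreover have "v \<bullet> (P *\<^sub>v v) > 0" if v: "v \<in> carrier_vec d" "v \<noteq> 0\<^sub>v d" for v
  proof -
    have "\<exists>i<d. v $ i \<noteq> 0"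
    proof (rule ccontr)
      assume "\<not> ?thesis"
      then have "v = 0\<^sub>v d" using v by (intro eq_vecI) auto
      with v show False by simp
    qed
    with r v(1) P show ?thesis by (simp add: scalar_prod_mult_mat_vec_eq_quad_form)
  qed
  ultimately show ?l using P by (simp add: pos_def_def)
qed

lemma quad_form_pos:
  assumes "pos_def d P" "i < d" "x i \<noteq> 0" shows "0 < quad_form d P x"
  using assms(1)[unfolded pos_def_iff_quad_form, THEN conjunct2, THEN conjunct2] assms(2,3) by blast

lemma pos_def_sym: "pos_def d P \<Longrightarrow> i < d \<Longrightarrow> j < d \<Longrightarrow> P $$ (i, j) = P $$ (j, i)"
  unfolding pos_def_iff_quad_form by blast

lemma quad_form_cong: "(\<And>i. i < d \<Longrightarrow> x i = y i) \<Longrightarrow> quad_form d P x = quad_form d P y"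
  by (simp add: quad_form_def)

lemma quad_form_nonneg: "pos_def d P \<Longrightarrow> 0 \<le> quad_form d P x"
proof (cases "\<exists>i<d. x i \<noteq> 0")
  case False
  then have "quad_form d P x = quad_form d P (\<lambda>_. 0)" by (intro quad_form_cong) auto
  then show ?thesis by (simp add: quad_form_def)
qed (auto simp: pos_def_iff_quad_form less_imp_le)

lemma quad_form_smult: "P \<in> carrier_mat d d \<Longrightarrow> quad_form d (c \<cdot>\<^sub>m P) x = c * quad_form d P x"
  by (simp add: quad_form_def sum_distrib_left mult_ac)

lemma pos_def_smult: "pos_def d S \<Longrightarrow> 0 < c \<Longrightarrow> pos_def d (c \<cdot>\<^sub>m S)"
  by (auto simp: pos_def_iff_quad_form quad_form_smult)

lemma quad_form_one: "quad_form d (1\<^sub>m d) x = (\<Sum>i<d. (x i)\<^sup>2)"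
  by (simp add: quad_form_def if_distrib[of "\<lambda>a. a * _"] sum.delta power2_eq_square cong: if_cong)

lemma pos_def_one: "pos_def d (1\<^sub>m d)"
proof -
  have "0 < (\<Sum>i<d. (x i)\<^sup>2)" if "i < d" "x i \<noteq> 0" for x :: "nat \<Rightarrow> real" and i
    using that by (intro sum_pos2[of _ i]) auto
  then show ?thesis
    by (auto simp: pos_def_iff_quad_form quad_form_one)
qed

lemma pos_def_diag:
  assumes S: "pos_def d S" and i: "i < d" shows "0 < S $$ (i, i)"
proof -
  have "0 < quad_form d S (\<lambda>j. if j = i then 1 else 0)"
    using S i unfolding pos_def_iff_quad_form by force
  also have "\<dots> = S $$ (i, i)"
    using i by (simp add: quad_form_def if_distrib[of "\<lambda>a. _ * a"] cong: if_cong)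
  finally show ?thesis .
qed

section \<open>Schur complements with respect to the last coordinate\<close>

definition schur_compl :: "nat \<Rightarrow> real mat \<Rightarrow> real mat" where
  "schur_compl d P = mat d d (\<lambda>(i, j). P $$ (i, j) - P $$ (i, d) * P $$ (d, j) / P $$ (d, d))"

text \<open>Completing the square in the last coordinate. It drives the inductions on the dimension,
  since only the first summand involves \<open>x d\<close>.\<close>

lemma quad_form_Suc:
  assumes P: "pos_def (Suc d) P"
  shows "quad_form (Suc d) P x =
    P $$ (d, d) * (x d + (\<Sum>i<d. P $$ (i, d) * x i) / P $$ (d, d))\<^sup>2 + quad_form d (schur_compl d P) x"
proof -
  define c u where "c = P $$ (d, d)" and "u = (\<Sum>i<d. P $$ (i, d) * x i)"
  have c: "c \<noteq> 0" using pos_def_diag[OF P lessI] by (simp add: c_def)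
  have sym: "P $$ (d, j) = P $$ (j, d)" if "j < d" for j
    using P that by (simp add: pos_def_iff_quad_form)
  have "quad_form (Suc d) P x = quad_form d P x + 2 * u * x d + c * (x d)\<^sup>2"
    by (simp add: quad_form_def sum.distrib sym c_def u_def sum_distrib_right sum_distrib_left power2_eq_square algebra_simps)
  moreover have "quad_form d (schur_compl d P) x = quad_form d P x - u\<^sup>2 / c"
    by (simp add: quad_form_def schur_compl_def sym c_def u_def sum_product power2_eq_square
        sum_divide_distrib sum_subtractf[symmetric] algebra_simps)
  moreover have "c * (x d + u / c)\<^sup>2 = c * (x d)\<^sup>2 + 2 * u * x d + u\<^sup>2 / c"
    using c by (simp add: power2_eq_square field_simps)
  ultimately have "quad_form (Suc d) P x = c * (x d + u / c)\<^sup>2 + quad_form d (schur_compl d P) x"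
    by simp
  then show ?thesis unfolding c_def u_def .
qed

lemma pos_def_schur_compl:
  assumes P: "pos_def (Suc d) P" shows "pos_def d (schur_compl d P)"
  unfolding pos_def_iff_quad_form
proof (intro conjI allI impI)
  fix x :: "nat \<Rightarrow> real" assume x: "\<exists>i<d. x i \<noteq> 0"
  \<comment> \<open>The last coordinate is chosen to make the completed square vanish, leaving only
    the form of the Schur complement.\<close>
  define y where "y = x(d := - (\<Sum>i<d. P $$ (i, d) * x i) / P $$ (d, d))"
  obtain i where "i < d" "x i \<noteq> 0" using x by blast
  then have "\<exists>i<Suc d. y i \<noteq> 0" by (intro exI[of _ i]) (simp add: y_def)
  then have "0 < quad_form (Suc d) P y"
    using P unfolding pos_def_iff_quad_form by blast
  also have "\<dots> = quad_form d (schur_compl d P) y"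
    by (subst quad_form_Suc[OF P]) (simp add: y_def)
  also have "\<dots> = quad_form d (schur_compl d P) x"
    by (intro quad_form_cong) (simp add: y_def)
  finally show "0 < quad_form d (schur_compl d P) x" .
qed (use P in \<open>auto simp: schur_compl_def pos_def_iff_quad_form\<close>)

text \<open>Block factorization of \<open>P\<close> into a unit upper triangular matrix
  \<open>L\<close> and a block lower triangular matrix \<open>R\<close> whose diagonal blocks are
  the Schur complement and the last diagonal entry.\<close>

lemma det_schur_compl:
  assumes P: "pos_def (Suc d) P"
  shows "det P = P $$ (d, d) * det (schur_compl d P)"
proof -
  let ?c = "P $$ (d, d)"
  define L where "L = four_block_mat (1\<^sub>m d) (mat d 1 (\<lambda>(i, _). P $$ (i, d) / ?c)) (0\<^sub>m 1 d) (1\<^sub>m 1)"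
  define R where "R = four_block_mat (schur_compl d P) (0\<^sub>m d 1) (mat 1 d (\<lambda>(_, j). P $$ (d, j))) (mat 1 1 (\<lambda>_. ?c))"
  have [simp]: "schur_compl d P \<in> carrier_mat d d" by (simp add: schur_compl_def)
  have c: "?c \<noteq> 0" using pos_def_diag[OF P lessI] by simp
  have PC: "P \<in> carrier_mat (Suc d) (Suc d)" using P by (simp add: pos_def_def)
  have L: "L \<in> carrier_mat (d + 1) (d + 1)" and R: "R \<in> carrier_mat (d + 1) (d + 1)"
    unfolding L_def R_def by (intro four_block_carrier_mat; simp)+
  have "P = L * R"
    unfolding L_def R_def
    by (subst mult_four_block_mat[where ?n1.0 = d and ?n2.0 = 1])
      (use PC c in \<open>auto simp: schur_compl_def scalar_prod_def less_Suc_eq intro!: eq_matI\<close>)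
  then have "det P = det L * det R" using det_mult[OF L R] by simp
  also have "det L = 1"
    unfolding L_def by (subst det_four_block_mat_lower_left_zero[where n = d and m = 1]) auto
  also have "det R = det (schur_compl d P) * ?c"
    unfolding R_def by (subst det_four_block_mat_upper_right_zero[where n = d and m = 1]) (auto simp: det_single)
  finally show ?thesis by simp
qed

lemma det_pos_def: "pos_def d P \<Longrightarrow> 0 < det P"
proof (induction d arbitrary: P)
  case 0
  then show ?case by (simp add: pos_def_def)
next
  case (Suc d)
  then show ?case
    using pos_def_diag pos_def_schur_compl by (simp add: det_schur_compl)
qed

section \<open>Lebesgue integration on \<open>Rspace\<close> and the Gaussian integral\<close>

interpretation lebesgue: product_sigma_finite "\<lambda>_. lborel :: real measure"
  by standard

lemma sigma_finite_Rspace: "sigma_finite_measure (Rspace d)"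
  unfolding Rspace_def by (rule lebesgue.sigma_finite) simp

lemma measurable_Rspace_component [measurable]: "i < d \<Longrightarrow> (\<lambda>x. x i) \<in> borel_measurable (Rspace d)"
  unfolding Rspace_def by (subst measurable_lborel1[symmetric], rule measurable_component_singleton) simp

lemma measurable_quad_form [measurable]:
  assumes [measurable]: "\<And>i. i < d \<Longrightarrow> (\<lambda>x. X x i) \<in> borel_measurable M"
  shows "(\<lambda>x. quad_form d P (X x)) \<in> borel_measurable M"
proof -
  have [measurable]: "i \<in> {..<d} \<Longrightarrow> (\<lambda>x. X x i) \<in> borel_measurable M" for i by (simp add: assms)
  show ?thesis unfolding quad_form_def by measurable
qed

text \<open>Up to the factor on the right, the integrand is the normal density with mean
  \<open>- u\<close> and variance \<open>1 / c\<close>.\<close>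

lemma nn_integral_gaussian_1d:
  assumes "0 < c"
  shows "(\<integral>\<^sup>+y. exp (- (c * (y + u)\<^sup>2 / 2)) \<partial>lborel) = sqrt (2 * pi / c)"
proof -
  have "exp (- (c * (y + u)\<^sup>2 / 2)) = sqrt (2 * pi / c) * normal_density (- u) (1 / sqrt c) y" for y
    using assms by (simp add: normal_density_def power_divide real_sqrt_divide mult_ac)
  then have "(\<integral>\<^sup>+y. exp (- (c * (y + u)\<^sup>2 / 2)) \<partial>lborel) =
      sqrt (2 * pi / c) * (\<integral>\<^sup>+y. normal_density (- u) (1 / sqrt c) y \<partial>lborel)"
    using assms by (simp add: ennreal_mult nn_integral_cmult)
  also have "(\<integral>\<^sup>+y. normal_density (- u) (1 / sqrt c) y \<partial>lborel) = 1"
    using assms by (subst nn_integral_eq_integral) auto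
  finally show ?thesis by simp
qed

text \<open>Induction on the dimension: after completing the square, the integral over the last
  coordinate does not depend on the others, and what remains is the Gaussian integral of the Schur
  complement. The constants combine by \<open>det_schur_compl\<close>.\<close>

lemma nn_integral_exp_quad_form:
  assumes "pos_def d P"
  shows "(\<integral>\<^sup>+x. exp (- quad_form d P x / 2) \<partial>Rspace d) = sqrt ((2 * pi) ^ d / det P)"
  using assms
proof (induction d arbitrary: P)
  case 0
  then show ?case by (simp add: Rspace_def PiM_empty quad_form_def pos_def_def nn_integral_count_space_finite)
next
  case (Suc d)
  let ?c = "P $$ (d, d)" and ?Q = "schur_compl d P"
  have c: "0 < ?c" by (rule pos_def_diag[OF Suc.prems lessI])
  have Q: "pos_def d ?Q" by (rule pos_def_schur_compl[OF Suc.prems])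
  have ins: "{..<Suc d} = insert d {..<d}" by auto
  have m: "(\<lambda>x. ennreal (exp (- quad_form (Suc d) P x / 2))) \<in> borel_measurable (Pi\<^sub>M (insert d {..<d}) (\<lambda>_. lborel))"
    unfolding ins[symmetric] Rspace_def[symmetric] by measurable
  have "(\<integral>\<^sup>+x. exp (- quad_form (Suc d) P x / 2) \<partial>Rspace (Suc d)) =
      (\<integral>\<^sup>+x. (\<integral>\<^sup>+y. exp (- quad_form (Suc d) P (x(d := y)) / 2) \<partial>lborel) \<partial>Rspace d)"
    unfolding Rspace_def ins by (subst lebesgue.product_nn_integral_insert[OF _ _ m]) auto
  also have "\<dots> = (\<integral>\<^sup>+x. ennreal (exp (- quad_form d ?Q x / 2)) * sqrt (2 * pi / ?c) \<partial>Rspace d)"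
  proof (rule nn_integral_cong)
    fix x
    define u where "u = (\<Sum>i<d. P $$ (i, d) * x i) / ?c"
    have "quad_form (Suc d) P (x(d := y)) = ?c * (y + u)\<^sup>2 + quad_form d ?Q x" for y
      by (simp add: quad_form_Suc[OF Suc.prems] u_def cong: quad_form_cong)
    then have "exp (- quad_form (Suc d) P (x(d := y)) / 2) =
        exp (- quad_form d ?Q x / 2) * exp (- (?c * (y + u)\<^sup>2 / 2))" for y
      unfolding exp_add[symmetric] by (intro arg_cong[of _ _ exp]) (simp add: field_simps)
    then have "(\<integral>\<^sup>+y. exp (- quad_form (Suc d) P (x(d := y)) / 2) \<partial>lborel) =
       (\<integral>\<^sup>+y. ennreal (exp (- quad_form d ?Q x / 2)) * exp (- (?c * (y + u)\<^sup>2 / 2)) \<partial>lborel)"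
      by (simp add: ennreal_mult)
    also have "\<dots> = ennreal (exp (- quad_form d ?Q x / 2)) * sqrt (2 * pi / ?c)"
      by (simp add: nn_integral_cmult nn_integral_gaussian_1d[OF c])
    finally show "(\<integral>\<^sup>+y. exp (- quad_form (Suc d) P (x(d := y)) / 2) \<partial>lborel) =
      ennreal (exp (- quad_form d ?Q x / 2)) * sqrt (2 * pi / ?c)" .
  qed
  also have "\<dots> = ennreal (sqrt ((2 * pi) ^ d / det ?Q)) * sqrt (2 * pi / ?c)"
    by (subst nn_integral_multc, measurable) (simp only: Suc.IH[OF Q])
  also have "\<dots> = sqrt ((2 * pi) ^ d / det ?Q * (2 * pi / ?c))"
    unfolding real_sqrt_mult using c det_pos_def[OF Q] by (intro ennreal_mult[symmetric]) auto
  also have "(2 * pi) ^ d / det ?Q * (2 * pi / ?c) = (2 * pi) ^ Suc d / det P"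
    unfolding det_schur_compl[OF Suc.prems] by (simp add: mult_ac)
  finally show ?case .
qed

section \<open>Inverses of positive definite matrices\<close>

lemma mat_inv:
  assumes S: "S \<in> carrier_mat d d" and "det S \<noteq> 0"
  shows mat_inv_carrier: "mat_inv S \<in> carrier_mat d d"
    and mult_mat_inv: "S * mat_inv S = 1\<^sub>m d" and mat_inv_mult: "mat_inv S * S = 1\<^sub>m d"
proof -
  have "S \<in> Units (ring_mat TYPE(real) d ())" by (rule det_non_zero_imp_unit[OF assms])
  then obtain P where "mat_inverse S = Some P"
    using mat_inverse(1)[OF S, where b = "()"] by (cases "mat_inverse S") auto
  with mat_inverse(2)[OF S this]
  show "mat_inv S \<in> carrier_mat d d" "S * mat_inv S = 1\<^sub>m d" "mat_inv S * S = 1\<^sub>m d"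
    by (auto simp: mat_inv_def)
qed

lemma mat_inv_eqI:
  assumes S: "S \<in> carrier_mat d d" and P: "P \<in> carrier_mat d d" and SP: "S * P = 1\<^sub>m d"
  shows "mat_inv S = P"
proof -
  have "det S * det P = 1" using det_mult[OF S P] SP by simp
  then have "det S \<noteq> 0" by auto
  note inv = mat_inv[OF S this]
  have "mat_inv S = mat_inv S * (S * P)" using inv(1) SP by simp
  also have "\<dots> = mat_inv S * S * P" using inv(1) S P by (simp add: assoc_mult_mat)
  also have "\<dots> = P" using inv(3) P by simp
  finally show ?thesis .
qed

lemma mat_inv_pos_def:
  assumes S: "pos_def d S"
  shows "mat_inv S \<in> carrier_mat d d" "S * mat_inv S = 1\<^sub>m d" "mat_inv S * S = 1\<^sub>m d"
  using mat_inv[of S d] det_pos_def[OF S] S by (auto simp: pos_def_def)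

text \<open>Positivity follows by substituting \<open>v = S y\<close>, which turns the form of the
  inverse at \<open>v\<close> into the form of \<open>S\<close> at \<open>y\<close>.\<close>

lemma pos_def_mat_inv:
  assumes S: "pos_def d S" shows "pos_def d (mat_inv S)"
proof -
  let ?P = "mat_inv S"
  note P = mat_inv_pos_def[OF S]
  have SC: "S \<in> carrier_mat d d" and T: "S\<^sup>T = S" using S by (auto simp: pos_def_def)
  \<comment> \<open>Transposing \<open>S * ?P = 1\<close> gives a left inverse of the symmetric
    matrix \<open>S\<close>; left and right inverses agree, so \<open>?P\<close> is
    symmetric.\<close>
  have "?P\<^sup>T * S = 1\<^sub>m d"
    using transpose_mult[OF SC P(1)] P(2) T by simp
  then have "?P = ?P\<^sup>T * S * ?P" using P(1) by simp
  also have "\<dots> = ?P\<^sup>T" using P SC by (simp add: assoc_mult_mat[of _ d d _ d _ d])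
  finally have PT: "?P\<^sup>T = ?P" by simp
  have "v \<bullet> (?P *\<^sub>v v) > 0" if v: "v \<in> carrier_vec d" "v \<noteq> 0\<^sub>v d" for v
  proof -
    define y where "y = ?P *\<^sub>v v"
    have y: "y \<in> carrier_vec d" using P v by (simp add: y_def)
    have Sy: "S *\<^sub>v y = v"
      unfolding y_def using P SC v by (simp add: assoc_mult_mat_vec[symmetric])
    have "y \<noteq> 0\<^sub>v d" using Sy SC v(2) by (auto intro!: eq_vecI)
    then have "0 < y \<bullet> (S *\<^sub>v y)" using S y by (auto simp: pos_def_def)
    then show ?thesis
      using Sy comm_scalar_prod[OF y v(1)] by (simp add: y_def)
  qed
  with P(1) PT show ?thesis by (simp add: pos_def_def)
qed

lemma mat_inv_smult:
  assumes S: "pos_def d S" and c: "c \<noteq> 0"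
  shows "mat_inv (c \<cdot>\<^sub>m S) = (1 / c) \<cdot>\<^sub>m mat_inv S"
proof (rule mat_inv_eqI[of _ d])
  note P = mat_inv_pos_def[OF S]
  have SC: "S \<in> carrier_mat d d" using S by (auto simp: pos_def_def)
  show "c \<cdot>\<^sub>m S * ((1 / c) \<cdot>\<^sub>m mat_inv S) = 1\<^sub>m d"
    using P SC c
    by (simp add: mult_smult_assoc_mat[of _ d d _ d] mult_smult_distrib[of _ d d _ d]) (auto intro!: eq_matI)
qed (use S in \<open>auto simp: pos_def_def mat_inv_pos_def\<close>)

text \<open>Cauchy-Schwarz for the inner product given by the inverse of \<open>S\<close>: the
  product of \<open>x\<close> with column \<open>i\<close> of \<open>S\<close> is
  \<open>x i\<close>, and the squared norm of that column is \<open>S $$ (i, i)\<close>. It bounds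
  second moments by the exponent of the Gaussian density.\<close>

lemma sq_le_quad_form_mat_inv:
  assumes S: "pos_def d S" and i: "i < d"
  shows "(x i)\<^sup>2 \<le> S $$ (i, i) * quad_form d (mat_inv S) x"
proof -
  let ?P = "mat_inv S" and ?s = "S $$ (i, i)"
  have SC: "S \<in> carrier_mat d d" using S by (auto simp: pos_def_def)
  have P: "pos_def d ?P" by (rule pos_def_mat_inv[OF S])
  have PC: "?P \<in> carrier_mat d d" by (rule mat_inv_pos_def[OF S])
  have PS: "(\<Sum>k<d. ?P $$ (j, k) * S $$ (k, i)) = (if j = i then 1 else 0)" if "j < d" for j
    using arg_cong[OF mat_inv_pos_def(3)[OF S], of "\<lambda>M. M $$ (j, i)"] that i SC PC
    by (simp add: scalar_prod_def lessThan_atLeast0)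
  have s: "0 < ?s" by (rule pos_def_diag[OF S i])
  have expand: "quad_form d ?P (\<lambda>j. x j - t * S $$ (j, i)) = quad_form d ?P x - 2 * t * x i + t\<^sup>2 * ?s" for t
  proof -
    have sym: "?P $$ (j, k) = ?P $$ (k, j)" if "j < d" "k < d" for j k
      using P that by (simp add: pos_def_iff_quad_form)
    have 1: "(\<Sum>j<d. \<Sum>k<d. ?P $$ (j, k) * y j * S $$ (k, i)) = y i" for y :: "nat \<Rightarrow> real"
    proof -
      have "(\<Sum>j<d. \<Sum>k<d. ?P $$ (j, k) * y j * S $$ (k, i)) =
        (\<Sum>j<d. y j * (\<Sum>k<d. ?P $$ (j, k) * S $$ (k, i)))"
        by (simp add: sum_distrib_left mult_ac)
      also have "\<dots> = y i" using i by (simp add: PS if_distrib[of "\<lambda>a. _ * a"] cong: if_cong)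
      finally show ?thesis .
    qed
    have 2: "(\<Sum>j<d. \<Sum>k<d. ?P $$ (j, k) * S $$ (j, i) * x k) = x i"
    proof -
      have "(\<Sum>j<d. \<Sum>k<d. ?P $$ (j, k) * S $$ (j, i) * x k) = (\<Sum>k<d. \<Sum>j<d. ?P $$ (k, j) * x k * S $$ (j, i))"
        by (subst sum.swap) (auto intro!: sum.cong simp: sym mult_ac)
      then show ?thesis using 1 by simp
    qed
    have "quad_form d ?P (\<lambda>j. x j - t * S $$ (j, i)) = quad_form d ?P x
       - t * (\<Sum>j<d. \<Sum>k<d. ?P $$ (j, k) * x j * S $$ (k, i))
       - t * (\<Sum>j<d. \<Sum>k<d. ?P $$ (j, k) * S $$ (j, i) * x k)
       + t\<^sup>2 * (\<Sum>j<d. \<Sum>k<d. ?P $$ (j, k) * S $$ (j, i) * S $$ (k, i))"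
      unfolding quad_form_def sum_distrib_left sum_subtractf[symmetric] sum.distrib[symmetric]
      by (intro sum.cong refl) (simp add: power2_eq_square algebra_simps)
    then show ?thesis by (simp add: 1[of x] 1[of "\<lambda>j. S $$ (j, i)"] 2)
  qed
  \<comment> \<open>The value \<open>t = x i / ?s\<close> minimizes the quadratic polynomial in
    \<open>expand\<close>.\<close>
  have "0 \<le> quad_form d ?P (\<lambda>j. x j - x i / ?s * S $$ (j, i))"
    by (rule quad_form_nonneg[OF P])
  also have "\<dots> = quad_form d ?P x - (x i)\<^sup>2 / ?s"
    unfolding expand using s by (simp add: power2_eq_square field_simps)
  finally show ?thesis using s by (simp add: field_simps)
qed

section \<open>Gaussian densities: normalization and moment bounds\<close>

lemma gauss_density_eq:
  assumes "pos_def d S" "mu \<in> carrier_vec d"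
  shows "gauss_density d mu S x =
    exp (- quad_form d (mat_inv S) (\<lambda>i. x i - mu $ i) / 2) / sqrt ((2 * pi) ^ d * det S)"
proof -
  have "(vec d x - mu) \<bullet> (mat_inv S *\<^sub>v (vec d x - mu)) = quad_form d (mat_inv S) (\<lambda>i. (vec d x - mu) $ i)"
    using assms by (intro scalar_prod_mult_mat_vec_eq_quad_form mat_inv_pos_def) auto
  also have "\<dots> = quad_form d (mat_inv S) (\<lambda>i. x i - mu $ i)"
    using assms by (intro quad_form_cong) simp
  finally show ?thesis by (simp add: gauss_density_def)
qed

lemma gauss_density_pos: "pos_def d S \<Longrightarrow> 0 < gauss_density d mu S x"
  by (auto simp: gauss_density_def det_pos_def)

lemma measurable_gauss_density:
  assumes S: "pos_def d S" and mu: "\<And>w. mu w \<in> carrier_vec d"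
    and [measurable]: "\<And>i. i < d \<Longrightarrow> (\<lambda>w. mu w $ i) \<in> borel_measurable M"
      "\<And>i. i < d \<Longrightarrow> (\<lambda>w. X w i) \<in> borel_measurable M"
  shows "(\<lambda>w. gauss_density d (mu w) S (X w)) \<in> borel_measurable M"
  unfolding gauss_density_eq[OF S mu] by measurable

lemma nn_integral_gauss_density:
  assumes S: "pos_def d S"
  shows "(\<integral>\<^sup>+x. gauss_density d (0\<^sub>v d) S x \<partial>Rspace d) = 1"
proof -
  have P: "pos_def d (mat_inv S)" by (rule pos_def_mat_inv[OF S])
  have SC: "S \<in> carrier_mat d d" using S by (auto simp: pos_def_def)
  have "det S * det (mat_inv S) = 1"
    using det_mult[OF SC mat_inv_pos_def(1)[OF S]] mat_inv_pos_def(2)[OF S] by simp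
  then have "det S = 1 / det (mat_inv S)"
    using det_pos_def[OF P] by (simp add: nonzero_eq_divide_eq)
  then have D: "(2 * pi) ^ d * det S = (2 * pi) ^ d / det (mat_inv S)"
    by (simp only: times_divide_eq_right mult_1_right)
  let ?k = "sqrt ((2 * pi) ^ d / det (mat_inv S))"
  have k: "0 < ?k" using det_pos_def[OF P] by simp
  have "gauss_density d (0\<^sub>v d) S x = 1 / ?k * exp (- quad_form d (mat_inv S) x / 2)" for x
    unfolding gauss_density_eq[OF S zero_carrier_vec] D by (simp cong: quad_form_cong)
  then have "(\<integral>\<^sup>+x. gauss_density d (0\<^sub>v d) S x \<partial>Rspace d) =
      (\<integral>\<^sup>+x. ennreal (1 / ?k) * exp (- quad_form d (mat_inv S) x / 2) \<partial>Rspace d)"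
    using k by (subst ennreal_mult[symmetric]) auto
  also have "\<dots> = ennreal (1 / ?k) * ?k"
    by (subst nn_integral_cmult, measurable) (simp only: nn_integral_exp_quad_form[OF P])
  also have "\<dots> = 1" using k by (subst ennreal_mult[symmetric]) auto
  finally show ?thesis .
qed

lemma quad_form_isotropic:
  assumes "0 < s2"
  shows "quad_form d (mat_inv (s2 \<cdot>\<^sub>m 1\<^sub>m d)) x = (\<Sum>i<d. (x i)\<^sup>2) / s2"
proof -
  have "mat_inv (s2 \<cdot>\<^sub>m 1\<^sub>m d) = (1 / s2) \<cdot>\<^sub>m 1\<^sub>m d"
    using assms mat_inv_eqI[of "1\<^sub>m d" d "1\<^sub>m d"] by (subst mat_inv_smult[OF pos_def_one]) auto
  then show ?thesis
    by (simp add: quad_form_smult quad_form_one)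
qed

lemma gauss_density_isotropic:
  assumes s2: "0 < s2" and mu: "mu \<in> carrier_vec d"
  shows "gauss_density d mu (s2 \<cdot>\<^sub>m 1\<^sub>m d) z = exp (- (\<Sum>i<d. (z i - mu $ i)\<^sup>2) / (2 * s2)) / sqrt ((2 * pi * s2) ^ d)"
  using s2 mu
  by (simp add: gauss_density_eq[OF pos_def_smult[OF pos_def_one s2]] quad_form_isotropic power_mult_distrib mult_ac)

text \<open>With isotropic covariance the density is a product of one-dimensional normal densities,
  so an arbitrary mean is handled coordinate by coordinate, without translating the whole
  space.\<close>

lemma nn_integral_gauss_density_isotropic:
  assumes s2: "0 < s2" and mu: "mu \<in> carrier_vec d"
  shows "(\<integral>\<^sup>+z. gauss_density d mu (s2 \<cdot>\<^sub>m 1\<^sub>m d) z \<partial>Rspace d) = 1"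
proof -
  have "gauss_density d mu (s2 \<cdot>\<^sub>m 1\<^sub>m d) z = (\<Prod>i<d. normal_density (mu $ i) (sqrt s2) (z i))" for z
    using s2 by (simp add: gauss_density_isotropic[OF assms] normal_density_def prod_dividef
        exp_sum[symmetric] sum_negf sum_divide_distrib real_sqrt_power)
  then have "(\<integral>\<^sup>+z. gauss_density d mu (s2 \<cdot>\<^sub>m 1\<^sub>m d) z \<partial>Rspace d) =
      (\<integral>\<^sup>+z. (\<Prod>i<d. ennreal (normal_density (mu $ i) (sqrt s2) (z i))) \<partial>Rspace d)"
    by (simp add: prod_ennreal)
  also have "\<dots> = (\<Prod>i<d. \<integral>\<^sup>+y. normal_density (mu $ i) (sqrt s2) y \<partial>lborel)"
    unfolding Rspace_def by (subst lebesgue.product_nn_integral_prod) auto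
  also have "\<dots> = 1"
    using s2 by (intro prod.neutral ballI, subst nn_integral_eq_integral) auto
  finally show ?thesis .
qed

lemma gauss_density_isotropic_le:
  assumes s2: "0 < s2" and mu: "mu \<in> carrier_vec d"
  shows "gauss_density d mu (s2 \<cdot>\<^sub>m 1\<^sub>m d) z \<le> 1 / sqrt ((2 * pi * s2) ^ d)"
  unfolding gauss_density_isotropic[OF assms]
  using s2 by (intro divide_right_mono) (auto intro!: divide_nonneg_pos sum_nonneg)

text \<open>Trading half of the exponent for the quadratic factor: \<open>t exp (- t / 2) \<le> 4 exp (- t / 4)\<close>.\<close>

lemma quad_form_times_gauss_density_le:
  assumes S: "pos_def d S" and mu: "mu \<in> carrier_vec d"
  shows "quad_form d (mat_inv S) (\<lambda>i. x i - mu $ i) * gauss_density d mu S x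
    \<le> 4 * sqrt (2 ^ d) * gauss_density d mu (2 \<cdot>\<^sub>m S) x"
proof -
  define t where "t = quad_form d (mat_inv S) (\<lambda>i. x i - mu $ i)"
  have SC: "S \<in> carrier_mat d d" using S by (auto simp: pos_def_def)
  have S2: "pos_def d (2 \<cdot>\<^sub>m S)" by (rule pos_def_smult[OF S]) simp
  have "t / 4 \<le> exp (t / 4)" using exp_ge_add_one_self[of "t / 4"] by linarith
  then have "t * exp (- t / 2) \<le> 4 * exp (t / 4) * exp (- t / 2)"
    by (intro mult_right_mono) auto
  also have "\<dots> = 4 * exp (- t / 4)" by (simp add: exp_add[symmetric])
  finally have *: "t * exp (- t / 2) \<le> 4 * exp (- t / 4)" .
  have "quad_form d (mat_inv (2 \<cdot>\<^sub>m S)) (\<lambda>i. x i - mu $ i) = t / 2"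
    using mat_inv_pos_def(1)[OF S] by (simp add: mat_inv_smult[OF S] quad_form_smult t_def)
  moreover have "sqrt ((2 * pi) ^ d * det (2 \<cdot>\<^sub>m S)) = sqrt (2 ^ d) * sqrt ((2 * pi) ^ d * det S)"
    using SC by (simp add: real_sqrt_mult[symmetric] mult_ac)
  ultimately have "4 * sqrt (2 ^ d) * gauss_density d mu (2 \<cdot>\<^sub>m S) x = 4 * exp (- t / 4) / sqrt ((2 * pi) ^ d * det S)"
    unfolding gauss_density_eq[OF S2 mu] by simp
  moreover have "t * gauss_density d mu S x = t * exp (- t / 2) / sqrt ((2 * pi) ^ d * det S)"
    by (simp add: gauss_density_eq[OF S mu] t_def)
  ultimately show ?thesis
    unfolding t_def[symmetric] using * det_pos_def[OF S] by (simp add: divide_right_mono)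
qed

section \<open>Information of Gaussian channels\<close>

text \<open>The mean map \<open>m\<close> is left general, so that fully connected and convolution
  channels are both instances and can be compared.\<close>

locale gauss_channel =
  fixes p q :: nat and S :: "real mat" and s2 :: real and m :: "real vec \<Rightarrow> real vec"
  assumes S: "pos_def p S" and s2: "0 < s2"
    and m_carrier: "m (vec p x) \<in> carrier_vec q"
    and m_measurable [measurable]: "i < q \<Longrightarrow> (\<lambda>x. m (vec p x) $ i) \<in> borel_measurable (Rspace p)"
begin

abbreviation "src \<equiv> gauss_density p (0\<^sub>v p) S"

abbreviation "noise \<equiv> (\<lambda>x z. gauss_density q (m (vec p x)) (s2 \<cdot>\<^sub>m 1\<^sub>m q) z)"

lemma noise_cov: "pos_def q (s2 \<cdot>\<^sub>m 1\<^sub>m q)"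
  by (rule pos_def_smult[OF pos_def_one s2])

lemma src_measurable [measurable]: "src \<in> borel_measurable (Rspace p)"
  by (rule measurable_gauss_density[OF S, of "\<lambda>_. 0\<^sub>v p" _ "\<lambda>x. x"]) auto

lemma noise_measurable: "(\<lambda>(x, z). noise x z) \<in> borel_measurable (Rspace p \<Otimes>\<^sub>M Rspace q)"
  unfolding split_beta' by (rule measurable_gauss_density) (auto simp: m_carrier noise_cov)

text \<open>The bound on the noise density is its peak height, which is the same for every
  mean.\<close>

sublocale density_channel "Rspace p" "Rspace q" src noise "1 / sqrt ((2 * pi * s2) ^ q)"
proof (intro density_channel.intro density_channel_axioms.intro)
  show "sigma_finite_measure (Rspace p)" "sigma_finite_measure (Rspace q)"
    by (rule sigma_finite_Rspace)+
  show "(\<integral>\<^sup>+x. src x \<partial>Rspace p) = 1" by (rule nn_integral_gauss_density[OF S])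
  show "(\<integral>\<^sup>+z. noise x z \<partial>Rspace q) = 1" for x
    by (rule nn_integral_gauss_density_isotropic[OF s2 m_carrier])
qed (auto intro: gauss_density_pos S noise_cov noise_measurable
    simp only: gauss_density_isotropic_le[OF s2 m_carrier] src_measurable)

text \<open>A name for the property that is carried through the induction over blocks outside this
  locale.\<close>

definition "info_integrable \<longleftrightarrow> integrable joint info"

lemma gauss_channel_joint_eq: "gauss_channel_joint p q S s2 m = joint"
  by (simp add: gauss_channel_joint_def joint_def)

lemma gauss_channel_MI_eq: "gauss_channel_MI p q S s2 m = (\<integral>y. info y \<partial>joint)"
  by (simp add: gauss_channel_MI_def gauss_channel_joint_eq mutual_information_joint)

end

section \<open>Affine channels: bounds uniform in weights and bias\<close>

locale affine_gauss_channel =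
  fixes p q :: nat and S :: "real mat" and s2 :: real and W :: "real mat" and b :: "real vec"
  assumes S: "pos_def p S" and s2: "0 < s2" and W: "W \<in> carrier_mat q p" and b: "b \<in> carrier_vec q"
begin

definition "m x = W *\<^sub>v x + b"

lemma m_index: "i < q \<Longrightarrow> m (vec p x) $ i = (\<Sum>j<p. W $$ (i, j) * x j) + b $ i"
  using W b by (simp add: m_def scalar_prod_def lessThan_atLeast0)

sublocale gauss_channel p q S s2 m
proof
  show "(\<lambda>x. m (vec p x) $ i) \<in> borel_measurable (Rspace p)" if "i < q" for i
    unfolding m_index[OF that] by measurable
qed (use S s2 W b in \<open>auto simp: m_def\<close>)

text \<open>Cauchy-Schwarz in each row; the trace is the sum of the squared entries of
  \<open>W\<close>.\<close>

lemma dist_m_le: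
  assumes F: "mat_trace (W\<^sup>T * W) \<le> F"
  shows "(\<Sum>i<q. (m (vec p x) $ i - b $ i)\<^sup>2) \<le> F * (\<Sum>j<p. (x j)\<^sup>2)"
proof -
  have "(\<Sum>i<q. (m (vec p x) $ i - b $ i)\<^sup>2) = (\<Sum>i<q. (\<Sum>j<p. W $$ (i, j) * x j)\<^sup>2)"
    by (simp add: m_index)
  also have "\<dots> \<le> (\<Sum>i<q. (\<Sum>j<p. (W $$ (i, j))\<^sup>2) * (\<Sum>j<p. (x j)\<^sup>2))"
    by (intro sum_mono Cauchy_Schwarz_ineq_sum)
  also have "\<dots> = (\<Sum>j<p. \<Sum>i<q. (W $$ (i, j))\<^sup>2) * (\<Sum>j<p. (x j)\<^sup>2)"
    by (subst sum.swap) (simp add: sum_distrib_right)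
  also have "(\<Sum>j<p. \<Sum>i<q. (W $$ (i, j))\<^sup>2) = mat_trace (W\<^sup>T * W)"
    using W by (simp add: mat_trace_def scalar_prod_def lessThan_atLeast0 power2_eq_square)
  also have "mat_trace (W\<^sup>T * W) * (\<Sum>j<p. (x j)\<^sup>2) \<le> F * (\<Sum>j<p. (x j)\<^sup>2)"
    by (intro mult_right_mono F sum_nonneg) auto
  finally show ?thesis .
qed

end

text \<open>The constant in the lower bound for the output density: the expectation of the factor
  \<open>exp (- F * |x|^2 / s2)\<close> lost when the output profile is centred at the bias.\<close>

definition src_weight :: "nat \<Rightarrow> real mat \<Rightarrow> real \<Rightarrow> real \<Rightarrow> real" where
  "src_weight p S s2 F = (\<integral>x. gauss_density p (0\<^sub>v p) S x * exp (- F * (\<Sum>j<p. (x j)\<^sup>2) / s2) \<partial>Rspace p)"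

text \<open>The expectation of the right-hand side of \<open>abs_info_le\<close>, with the two
  second moments replaced by crude bounds; each \<open>4 * sqrt (2 ^ d)\<close> comes from
  \<open>quad_form_times_gauss_density_le\<close>. Weights and bias enter only through
  \<open>F\<close>.\<close>

definition src_bound :: "nat \<Rightarrow> nat \<Rightarrow> real mat \<Rightarrow> real \<Rightarrow> real \<Rightarrow> real" where
  "src_bound p q S s2 F = 2 * (4 * sqrt (2 ^ q)) + 2 * F / s2 * ((\<Sum>j<p. S $$ (j, j)) * (4 * sqrt (2 ^ p))) + \<bar>ln (src_weight p S s2 F)\<bar>"

context affine_gauss_channel begin

text \<open>Since \<open>|z - W x - b|\<^sup>2 \<le> 2 |z - b|\<^sup>2 + 2 |W x|\<^sup>2\<close>, the output density dominates a Gaussian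
  profile centred at \<open>b\<close>, with a constant that depends on \<open>W\<close> only through \<open>F\<close>.\<close>

lemma out_ge:
  assumes F: "mat_trace (W\<^sup>T * W) \<le> F" and F0: "0 \<le> F" and z: "z \<in> space (Rspace q)"
  shows "exp (- (\<Sum>i<q. (z i - b $ i)\<^sup>2) / s2) / sqrt ((2 * pi * s2) ^ q) * src_weight p S s2 F \<le> out z"
    and "0 < src_weight p S s2 F"
proof -
  let ?w = "\<lambda>x. src x * exp (- F * (\<Sum>j<p. (x j)\<^sup>2) / s2)"
  let ?k = "exp (- (\<Sum>i<q. (z i - b $ i)\<^sup>2) / s2) / sqrt ((2 * pi * s2) ^ q)"
  have int: "integrable (Rspace p) ?w"
  proof (rule Bochner_Integration.integrable_bound[OF integrable_f])
    have "F * (\<Sum>j<p. (x j)\<^sup>2) / s2 \<ge> 0" for x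
      using F0 s2 by (intro divide_nonneg_pos mult_nonneg_nonneg sum_nonneg) auto
    then show "AE x in Rspace p. norm (?w x) \<le> norm (src x)"
      by (intro AE_I2) (auto simp: abs_mult f_nonneg intro!: mult_left_le)
  qed measurable
  show "0 < src_weight p S s2 F"
    unfolding src_weight_def by (intro integral_pos int) (simp add: f_pos)
  have le: "?w x * ?k \<le> src x * noise x z" for x
  proof -
    have "(\<Sum>i<q. (z i - m (vec p x) $ i)\<^sup>2) \<le> (\<Sum>i<q. 2 * (z i - b $ i)\<^sup>2 + 2 * (m (vec p x) $ i - b $ i)\<^sup>2)"
    proof (rule sum_mono)
      fix i
      have "0 \<le> ((z i - b $ i) + (m (vec p x) $ i - b $ i))\<^sup>2" by simp
      then show "(z i - m (vec p x) $ i)\<^sup>2 \<le> 2 * (z i - b $ i)\<^sup>2 + 2 * (m (vec p x) $ i - b $ i)\<^sup>2"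
        by (simp add: power2_eq_square algebra_simps)
    qed
    also have "\<dots> \<le> 2 * (\<Sum>i<q. (z i - b $ i)\<^sup>2) + 2 * (F * (\<Sum>j<p. (x j)\<^sup>2))"
      using dist_m_le[OF F, of x] by (simp add: sum.distrib sum_distrib_left[symmetric])
    finally have "(\<Sum>i<q. (z i - m (vec p x) $ i)\<^sup>2) / (2 * s2) \<le>
        (2 * (\<Sum>i<q. (z i - b $ i)\<^sup>2) + 2 * (F * (\<Sum>j<p. (x j)\<^sup>2))) / (2 * s2)"
      using s2 by (intro divide_right_mono) auto
    then have "- (F * (\<Sum>j<p. (x j)\<^sup>2) / s2) + - (\<Sum>i<q. (z i - b $ i)\<^sup>2) / s2
        \<le> - (\<Sum>i<q. (z i - m (vec p x) $ i)\<^sup>2) / (2 * s2)"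
      by (simp add: add_divide_distrib)
    then have "exp (- F * (\<Sum>j<p. (x j)\<^sup>2) / s2) * exp (- (\<Sum>i<q. (z i - b $ i)\<^sup>2) / s2)
        \<le> exp (- (\<Sum>i<q. (z i - m (vec p x) $ i)\<^sup>2) / (2 * s2))"
      by (simp add: exp_add[symmetric])
    from mult_left_mono[OF divide_right_mono[OF this, of "sqrt ((2 * pi * s2) ^ q)"] f_nonneg[of x]]
    show ?thesis
      using s2 by (simp add: gauss_density_isotropic[OF s2 m_carrier] mult.assoc)
  qed
  have "?k * src_weight p S s2 F = (\<integral>x. ?w x * ?k \<partial>Rspace p)"
    unfolding src_weight_def by (subst integral_mult_left_zero) (rule mult.commute)
  also have "\<dots> \<le> out z"
    unfolding out_def by (intro integral_mono integrable_mult_left int integrable_fg z le)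
  finally show "?k * src_weight p S s2 F \<le> out z" .
qed

text \<open>The output density lies between the profile of \<open>out_ge\<close> and the peak of the
  noise density, which bounds the information density from both sides. The profile is centred at
  \<open>b\<close>; its exponent is re-centred at the conditional mean, at the price of a factor 2
  and a multiple of \<open>|x|^2\<close>.\<close>

lemma abs_info_le:
  assumes F: "mat_trace (W\<^sup>T * W) \<le> F" and F0: "0 \<le> F" and z: "z \<in> space (Rspace q)"
  shows "\<bar>info (x, z)\<bar> \<le> 2 * ((\<Sum>i<q. (z i - m (vec p x) $ i)\<^sup>2) / s2)
    + 2 * F / s2 * (\<Sum>j<p. (x j)\<^sup>2) + \<bar>ln (src_weight p S s2 F)\<bar>"
proof -
  define k where "k = 1 / sqrt ((2 * pi * s2) ^ q)"
  define N where "N = (\<Sum>i<q. (z i - m (vec p x) $ i)\<^sup>2)"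
  define D where "D = (\<Sum>i<q. (z i - b $ i)\<^sup>2)"
  define X where "X = (\<Sum>j<p. (x j)\<^sup>2)"
  define c where "c = src_weight p S s2 F"
  have k: "0 < k" using s2 by (simp add: k_def)
  have c: "0 < c" and out: "exp (- D / s2) * k * c \<le> out z"
    using out_ge[OF F F0 z] by (simp_all add: k_def c_def D_def)
  have N0: "0 \<le> N" and X0: "0 \<le> X" by (simp_all add: N_def X_def sum_nonneg)
  have noise: "noise x z = exp (- N / (2 * s2)) * k"
    by (simp add: gauss_density_isotropic[OF s2 m_carrier] k_def N_def)
  have "ln (noise x z) = - N / (2 * s2) + ln k" using k unfolding noise by (simp add: ln_mult_pos)
  then have info: "info (x, z) = - N / (2 * s2) + ln k - ln (out z)"
    unfolding info_def using g_pos[of x z] out_pos[OF z] by (simp add: ln_div)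
  have "ln (exp (- D / s2) * k * c) \<le> ln (out z)"
    using out k c out_pos[OF z] by (subst ln_le_cancel_iff) auto
  then have lo: "- (D / s2) + ln k + ln c \<le> ln (out z)"
    using k c by (simp add: ln_mult_pos)
  have "out z \<le> k"
    using out_le[OF z] by (simp only: k_def)
  then have hi: "ln (out z) \<le> ln k" using out_pos[OF z] by simp
  have "D \<le> (\<Sum>i<q. 2 * (z i - m (vec p x) $ i)\<^sup>2 + 2 * (m (vec p x) $ i - b $ i)\<^sup>2)"
    unfolding D_def
  proof (rule sum_mono)
    fix i
    have "0 \<le> ((z i - m (vec p x) $ i) - (m (vec p x) $ i - b $ i))\<^sup>2" by simp
    then show "(z i - b $ i)\<^sup>2 \<le> 2 * (z i - m (vec p x) $ i)\<^sup>2 + 2 * (m (vec p x) $ i - b $ i)\<^sup>2"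
      by (simp add: power2_eq_square algebra_simps)
  qed
  also have "\<dots> \<le> 2 * N + 2 * (F * X)"
    using dist_m_le[OF F, of x] by (simp add: sum.distrib sum_distrib_left[symmetric] N_def X_def)
  finally have "D / s2 \<le> (2 * N + 2 * (F * X)) / s2" using s2 by (intro divide_right_mono) auto
  then have D: "D / s2 \<le> 2 * (N / s2) + 2 * F / s2 * X" by (simp add: add_divide_distrib)
  have nonneg: "0 \<le> N / s2" "0 \<le> 2 * F / s2 * X" using N0 X0 F0 s2 by simp_all
  \<comment> \<open>The linear core of the estimate, with \<open>N / s2\<close>,
    \<open>2 * F / s2 * X\<close>, \<open>D / s2\<close>, \<open>ln k\<close>,
    \<open>ln (out z)\<close> and \<open>ln c\<close> abstracted to real variables.\<close>
  have "\<bar>- (n / 2) + k' - o'\<bar> \<le> 2 * n + Y + \<bar>l\<bar>"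
    if "0 \<le> n" "0 \<le> Y" "- d + k' + l \<le> o'" "o' \<le> k'" "d \<le> 2 * n + Y" for n Y d k' o' l :: real
    using that by linarith
  from this[OF nonneg lo hi D]
  have "\<bar>- (N / s2 / 2) + ln k - ln (out z)\<bar> \<le> 2 * (N / s2) + 2 * F / s2 * X + \<bar>ln c\<bar>" .
  then have "\<bar>info (x, z)\<bar> \<le> 2 * (N / s2) + 2 * F / s2 * X + \<bar>ln c\<bar>"
    by (simp add: info)
  then show ?thesis by (simp add: N_def X_def c_def)
qed

text \<open>The quadratic factor is absorbed by a Gaussian of doubled variance, whose mass is 1. The
  exact value is \<open>q\<close>, but a bound independent of \<open>x\<close>, \<open>W\<close> and
  \<open>b\<close> is enough.\<close>

lemma nn_integral_noise_moment:
  "(\<integral>\<^sup>+z. noise x z * ((\<Sum>i<q. (z i - m (vec p x) $ i)\<^sup>2) / s2) \<partial>Rspace q) \<le> 4 * sqrt (2 ^ q)"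
proof -
  have 2: "2 \<cdot>\<^sub>m (s2 \<cdot>\<^sub>m 1\<^sub>m q) = (2 * s2) \<cdot>\<^sub>m (1\<^sub>m q :: real mat)" by (auto intro!: eq_matI)
  have meas [measurable]: "(\<lambda>z. gauss_density q (m (vec p x)) ((2 * s2) \<cdot>\<^sub>m 1\<^sub>m q) z) \<in> borel_measurable (Rspace q)"
    using s2 by (intro measurable_gauss_density) (auto simp: m_carrier intro!: pos_def_smult pos_def_one)
  have "(\<integral>\<^sup>+z. noise x z * ((\<Sum>i<q. (z i - m (vec p x) $ i)\<^sup>2) / s2) \<partial>Rspace q)
    \<le> (\<integral>\<^sup>+z. ennreal (4 * sqrt (2 ^ q)) * gauss_density q (m (vec p x)) ((2 * s2) \<cdot>\<^sub>m 1\<^sub>m q) z \<partial>Rspace q)"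
  proof (intro nn_integral_mono)
    fix z
    have "noise x z * ((\<Sum>i<q. (z i - m (vec p x) $ i)\<^sup>2) / s2) \<le>
        4 * sqrt (2 ^ q) * gauss_density q (m (vec p x)) ((2 * s2) \<cdot>\<^sub>m 1\<^sub>m q) z"
      using quad_form_times_gauss_density_le[OF noise_cov m_carrier, of z x]
      by (simp add: quad_form_isotropic[OF s2] 2 mult.commute)
    then show "ennreal (noise x z * ((\<Sum>i<q. (z i - m (vec p x) $ i)\<^sup>2) / s2)) \<le>
        ennreal (4 * sqrt (2 ^ q)) * gauss_density q (m (vec p x)) ((2 * s2) \<cdot>\<^sub>m 1\<^sub>m q) z"
      by (subst ennreal_mult'[symmetric]) (auto intro: ennreal_leI)
  qed
  also have "\<dots> = 4 * sqrt (2 ^ q)"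
    using s2 by (subst nn_integral_cmult) (auto simp: nn_integral_gauss_density_isotropic m_carrier)
  finally show ?thesis .
qed

text \<open>Here \<open>|x|^2\<close> is at most the trace of \<open>S\<close> times the form of its
  inverse, which is again absorbed by doubling the covariance.\<close>

lemma nn_integral_src_moment:
  "(\<integral>\<^sup>+x. src x * (\<Sum>j<p. (x j)\<^sup>2) \<partial>Rspace p) \<le> (\<Sum>j<p. S $$ (j, j)) * (4 * sqrt (2 ^ p))"
proof -
  have S2: "pos_def p (2 \<cdot>\<^sub>m S)" by (rule pos_def_smult[OF S]) simp
  let ?t = "(\<Sum>j<p. S $$ (j, j))"
  have t0: "0 \<le> ?t" by (intro sum_nonneg less_imp_le pos_def_diag[OF S]) simp
  have [measurable]: "gauss_density p (0\<^sub>v p) (2 \<cdot>\<^sub>m S) \<in> borel_measurable (Rspace p)"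
    by (rule measurable_gauss_density[OF S2, of "\<lambda>_. 0\<^sub>v p" _ "\<lambda>x. x"]) auto
  have "(\<integral>\<^sup>+x. src x * (\<Sum>j<p. (x j)\<^sup>2) \<partial>Rspace p) \<le>
      (\<integral>\<^sup>+x. ennreal (?t * (4 * sqrt (2 ^ p))) * gauss_density p (0\<^sub>v p) (2 \<cdot>\<^sub>m S) x \<partial>Rspace p)"
  proof (intro nn_integral_mono)
    fix x
    have "(\<Sum>j<p. (x j)\<^sup>2) \<le> (\<Sum>j<p. S $$ (j, j) * quad_form p (mat_inv S) x)"
      by (intro sum_mono sq_le_quad_form_mat_inv[OF S]) auto
    also have "\<dots> = ?t * quad_form p (mat_inv S) x" by (rule sum_distrib_right[symmetric])
    finally have "src x * (\<Sum>j<p. (x j)\<^sup>2) \<le> ?t * (quad_form p (mat_inv S) x * src x)"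
      using mult_left_mono[OF _ f_nonneg[of x], of "\<Sum>j<p. (x j)\<^sup>2" "?t * quad_form p (mat_inv S) x"]
      by (simp only: mult_ac)
    also have "quad_form p (mat_inv S) x * src x \<le> 4 * sqrt (2 ^ p) * gauss_density p (0\<^sub>v p) (2 \<cdot>\<^sub>m S) x"
      using quad_form_times_gauss_density_le[OF S, of "0\<^sub>v p" x] by (simp cong: quad_form_cong)
    finally have "src x * (\<Sum>j<p. (x j)\<^sup>2) \<le> ?t * (4 * sqrt (2 ^ p) * gauss_density p (0\<^sub>v p) (2 \<cdot>\<^sub>m S) x)"
      using t0 by (simp add: mult_left_mono)
    then show "ennreal (src x * (\<Sum>j<p. (x j)\<^sup>2)) \<le> ennreal (?t * (4 * sqrt (2 ^ p))) * gauss_density p (0\<^sub>v p) (2 \<cdot>\<^sub>m S) x"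
      using t0 by (subst ennreal_mult'[symmetric]) (auto intro!: ennreal_leI simp: mult.assoc)
  qed
  also have "\<dots> = ?t * (4 * sqrt (2 ^ p))"
    by (subst nn_integral_cmult) (auto simp: nn_integral_gauss_density[OF S2])
  finally show ?thesis .
qed

lemma nn_integral_abs_info_le:
  assumes F: "mat_trace (W\<^sup>T * W) \<le> F" and F0: "0 \<le> F"
  shows "(\<integral>\<^sup>+y. \<bar>info y\<bar> \<partial>joint) \<le> src_bound p q S s2 F"
proof -
  let ?N = "\<lambda>x z. (\<Sum>i<q. (z i - m (vec p x) $ i)\<^sup>2) / s2" and ?X = "\<lambda>x. \<Sum>j<p. (x j)\<^sup>2"
  define l where "l = \<bar>ln (src_weight p S s2 F)\<bar>"
  define cN cX where "cN = 4 * sqrt (2 ^ q)" and "cX = (\<Sum>j<p. S $$ (j, j)) * (4 * sqrt (2 ^ p))"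
  have N0: "0 \<le> ?N x z" and X0: "0 \<le> ?X x" and l0: "0 \<le> l" for x z
    using s2 by (auto simp: l_def intro!: sum_nonneg divide_nonneg_pos)
  have f2: "0 \<le> 2 * F / s2" using F0 s2 by simp
  have [measurable]: "i \<in> {..<q} \<Longrightarrow> (\<lambda>x. m (vec p x) $ i) \<in> borel_measurable (Rspace p)"
    "j \<in> {..<p} \<Longrightarrow> (\<lambda>x. x j) \<in> borel_measurable (Rspace p)"
    "i \<in> {..<q} \<Longrightarrow> (\<lambda>x. x i) \<in> borel_measurable (Rspace q)" for i j by auto
  have "(\<integral>\<^sup>+y. \<bar>info y\<bar> \<partial>joint) \<le> (\<integral>\<^sup>+y. 2 * ?N (fst y) (snd y) + 2 * F / s2 * ?X (fst y) + l \<partial>joint)"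
    by (intro nn_integral_mono ennreal_leI) (use abs_info_le[OF F F0] in \<open>auto simp: l_def space_pair_measure\<close>)
  also have "\<dots> = (\<integral>\<^sup>+x. src x * (\<integral>\<^sup>+z. ennreal (noise x z) * (2 * ?N x z + 2 * F / s2 * ?X x + l) \<partial>Rspace q) \<partial>Rspace p)"
    by (subst nn_integral_joint) auto
  \<comment> \<open>The noise is averaged first: its moment is bounded uniformly in
    \<open>x\<close>, and the other two terms are constant in \<open>z\<close>.\<close>
  also have "\<dots> \<le> (\<integral>\<^sup>+x. src x * ennreal (2 * cN + 2 * F / s2 * ?X x + l) \<partial>Rspace p)"
  proof (intro nn_integral_mono mult_left_mono)
    fix x assume x: "x \<in> space (Rspace p)"
    have "(\<integral>\<^sup>+z. ennreal (noise x z) * (2 * ?N x z + 2 * F / s2 * ?X x + l) \<partial>Rspace q) =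
       (\<integral>\<^sup>+z. 2 * ennreal (noise x z * ?N x z) + ennreal (2 * F / s2 * ?X x + l) * noise x z \<partial>Rspace q)"
    proof (intro nn_integral_cong)
      fix z
      have "noise x z * (2 * ?N x z + 2 * F / s2 * ?X x + l) = 2 * (noise x z * ?N x z) + (2 * F / s2 * ?X x + l) * noise x z"
        by (simp only: algebra_simps)
      then show "ennreal (noise x z) * (2 * ?N x z + 2 * F / s2 * ?X x + l) = 2 * ennreal (noise x z * ?N x z) + ennreal (2 * F / s2 * ?X x + l) * noise x z"
        using N0[of z x] X0[of x] l0 f2 g_nonneg[of x z]
        by (simp only: ennreal_mult'[symmetric] ennreal_plus[symmetric] ennreal_numeral[symmetric] mult_nonneg_nonneg add_nonneg_nonneg zero_le_numeral)
    qed
    also have "\<dots> = 2 * (\<integral>\<^sup>+z. noise x z * ?N x z \<partial>Rspace q) + ennreal (2 * F / s2 * ?X x + l)"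
      using x by (subst nn_integral_add) (simp_all add: nn_integral_cmult nn_integral_g)
    also have "\<dots> \<le> 2 * ennreal cN + ennreal (2 * F / s2 * ?X x + l)"
      unfolding cN_def by (intro add_mono mult_left_mono nn_integral_noise_moment) auto
    also have "\<dots> = ennreal (2 * cN + 2 * F / s2 * ?X x + l)"
    proof -
      have "0 \<le> 2 * F / s2 * ?X x + l" using X0[of x] l0 f2 by (intro add_nonneg_nonneg mult_nonneg_nonneg)
      moreover have "2 * ennreal cN = ennreal (2 * cN)" by (subst ennreal_mult') auto
      moreover have "0 \<le> 2 * cN" by (simp add: cN_def)
      ultimately show ?thesis by (simp only: ennreal_plus[symmetric] add.assoc)
    qed
    finally show "(\<integral>\<^sup>+z. ennreal (noise x z) * (2 * ?N x z + 2 * F / s2 * ?X x + l) \<partial>Rspace q) \<le> ennreal (2 * cN + 2 * F / s2 * ?X x + l)" .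
  qed simp
  also have "\<dots> = (\<integral>\<^sup>+x. ennreal (2 * F / s2) * ennreal (src x * ?X x) + ennreal (2 * cN + l) * src x \<partial>Rspace p)"
  proof (intro nn_integral_cong)
    fix x
    have "src x * (2 * cN + 2 * F / s2 * ?X x + l) = 2 * F / s2 * (src x * ?X x) + (2 * cN + l) * src x"
      by (simp only: algebra_simps)
    moreover have "0 \<le> 2 * cN + l" using l0 by (simp add: cN_def)
    ultimately show "src x * ennreal (2 * cN + 2 * F / s2 * ?X x + l) = ennreal (2 * F / s2) * ennreal (src x * ?X x) + ennreal (2 * cN + l) * src x"
      using X0[of x] f2 f_nonneg[of x]
      by (simp only: ennreal_mult'[symmetric] ennreal_plus[symmetric] mult_nonneg_nonneg)
  qed
  also have "\<dots> = ennreal (2 * F / s2) * (\<integral>\<^sup>+x. src x * ?X x \<partial>Rspace p) + ennreal (2 * cN + l)"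
    by (subst nn_integral_add) (simp_all add: nn_integral_cmult nn_integral_f)
  also have "\<dots> \<le> ennreal (2 * F / s2) * ennreal cX + ennreal (2 * cN + l)"
    unfolding cX_def by (intro add_mono mult_left_mono nn_integral_src_moment) auto
  also have "\<dots> = src_bound p q S s2 F"
  proof -
    have "0 \<le> cX"
      unfolding cX_def by (intro mult_nonneg_nonneg sum_nonneg less_imp_le pos_def_diag[OF S]) auto
    with f2 have "0 \<le> 2 * F / s2 * cX" by (intro mult_nonneg_nonneg)
    moreover have "0 \<le> 2 * cN + l" using l0 by (simp add: cN_def)
    moreover have "src_bound p q S s2 F = 2 * F / s2 * cX + (2 * cN + l)"
      by (simp add: cN_def src_bound_def l_def cX_def)
    ultimately show ?thesis by (simp only: ennreal_mult'[OF f2, symmetric] ennreal_plus[symmetric])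
  qed
  finally show ?thesis .
qed

lemma integrable_info: "integrable joint info"
proof (rule integrableI_bounded)
  \<comment> \<open>Integrability for a single \<open>W\<close> may use any bound on its trace, so
    the trace itself serves; the maximum secures nonnegativity.\<close>
  let ?F = "max 0 (mat_trace (W\<^sup>T * W))"
  have "(\<integral>\<^sup>+y. norm (info y) \<partial>joint) \<le> src_bound p q S s2 ?F"
    using nn_integral_abs_info_le[of ?F] by simp
  also have "\<dots> < \<infinity>" by simp
  finally show "(\<integral>\<^sup>+y. norm (info y) \<partial>joint) < \<infinity>" .
qed measurable

text \<open>The uniform bound that makes the supremum meaningful. The maximum appears because
  \<open>ennreal\<close> truncates negative reals to 0.\<close>

lemma gauss_channel_MI_le:
  assumes F: "mat_trace (W\<^sup>T * W) \<le> F" and F0: "0 \<le> F"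
  shows "gauss_channel_MI p q S s2 m \<le> max 0 (src_bound p q S s2 F)"
proof -
  have "ennreal (\<integral>y. \<bar>info y\<bar> \<partial>joint) = (\<integral>\<^sup>+y. \<bar>info y\<bar> \<partial>joint)"
    by (intro nn_integral_eq_integral[symmetric] integrable_abs integrable_info) simp
  also have "\<dots> \<le> src_bound p q S s2 F" by (rule nn_integral_abs_info_le[OF F F0])
  finally have "(\<integral>y. \<bar>info y\<bar> \<partial>joint) \<le> max 0 (src_bound p q S s2 F)"
    by (auto simp: ennreal_le_iff2)
  moreover have "(\<integral>y. info y \<partial>joint) \<le> (\<integral>y. \<bar>info y\<bar> \<partial>joint)"
    by (intro integral_mono integrable_abs integrable_info) simp
  ultimately show ?thesis by (simp add: gauss_channel_MI_eq)
qed

end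

section \<open>Block decomposition\<close>

lemma sum_lessThan_add_split:
  fixes f :: "nat \<Rightarrow> 'a :: comm_monoid_add"
  shows "(\<Sum>i<a + b. f i) = (\<Sum>i<a. f i) + (\<Sum>i<b. f (a + i))"
  by (induction b) (simp_all add: add.assoc)

text \<open>The restriction makes the result extensional, as points of \<open>Rspace a\<close> must
  be; the same holds for \<open>tail_coords\<close>.\<close>

definition head_coords :: "nat \<Rightarrow> (nat \<Rightarrow> real) \<Rightarrow> nat \<Rightarrow> real" where
  "head_coords a x = (\<lambda>i\<in>{..<a}. x i)"

definition tail_coords :: "nat \<Rightarrow> nat \<Rightarrow> (nat \<Rightarrow> real) \<Rightarrow> nat \<Rightarrow> real" where
  "tail_coords a b x = (\<lambda>i\<in>{..<b}. x (a + i))"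

lemma measurable_head_coords [measurable]: "head_coords a \<in> measurable (Rspace (a + b)) (Rspace a)"
  unfolding head_coords_def Rspace_def[of a] by (rule measurable_restrict) simp

lemma measurable_tail_coords [measurable]: "tail_coords a b \<in> measurable (Rspace (a + b)) (Rspace b)"
  unfolding tail_coords_def Rspace_def[of b] by (rule measurable_restrict) simp

lemma measurable_tail_coords_PiM:
  "tail_coords a b \<in> measurable (PiM {a..<a + b} (\<lambda>_. lborel)) (Rspace b)"
  unfolding tail_coords_def Rspace_def
proof (rule measurable_restrict)
  fix i assume "i \<in> {..<b}"
  then show "(\<lambda>x. x (a + i)) \<in> measurable (PiM {a..<a + b} (\<lambda>_. lborel :: real measure)) lborel"
    by (intro measurable_component_singleton) simp
qed

text \<open>Shifting indices preserves Lebesgue measure. This is checked on boxes, which determine a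
  product measure: the preimage of a box is the box with its indices shifted by
  \<open>a\<close>.\<close>

lemma distr_tail_coords:
  "distr (PiM {a..<a + b} (\<lambda>_. lborel)) (Rspace b) (tail_coords a b) = Rspace b"
  unfolding Rspace_def
proof (rule lebesgue.PiM_eqI)
  fix A assume A: "\<And>i. i \<in> {..<b} \<Longrightarrow> A i \<in> sets (lborel :: real measure)"
  let ?P = "PiM {a..<a + b} (\<lambda>_. lborel :: real measure)"
  have m: "tail_coords a b \<in> measurable ?P (PiM {..<b} (\<lambda>_. lborel))"
    using measurable_tail_coords_PiM by (simp add: Rspace_def)
  have "tail_coords a b -` (Pi\<^sub>E {..<b} A) \<inter> space ?P = Pi\<^sub>E {a..<a + b} (\<lambda>i. A (i - a))"
  proof (intro Set.set_eqI iffI)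
    fix x assume x: "x \<in> tail_coords a b -` (Pi\<^sub>E {..<b} A) \<inter> space ?P"
    have "x i \<in> A (i - a)" if "i \<in> {a..<a + b}" for i
    proof -
      have "i - a < b" using that by auto
      then have "tail_coords a b x (i - a) \<in> A (i - a)" using x by (auto simp: PiE_iff)
      then show ?thesis using that \<open>i - a < b\<close> by (simp add: tail_coords_def)
    qed
    then show "x \<in> Pi\<^sub>E {a..<a + b} (\<lambda>i. A (i - a))" using x by (auto simp: space_PiM PiE_iff)
  next
    fix x assume x: "x \<in> Pi\<^sub>E {a..<a + b} (\<lambda>i. A (i - a))"
    have "x (a + i) \<in> A i" if "i < b" for i
      using PiE_mem[OF x, of "a + i"] that by simp
    with x show "x \<in> tail_coords a b -` (Pi\<^sub>E {..<b} A) \<inter> space ?P"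
      by (auto simp: space_PiM PiE_iff tail_coords_def)
  qed
  then have "emeasure (distr ?P (PiM {..<b} (\<lambda>_. lborel)) (tail_coords a b)) (Pi\<^sub>E {..<b} A) =
      emeasure ?P (Pi\<^sub>E {a..<a + b} (\<lambda>i. A (i - a)))"
    using A m by (subst emeasure_distr) (auto intro!: sets_PiM_I_finite)
  also have "\<dots> = (\<Prod>i\<in>{a..<a + b}. emeasure lborel (A (i - a)))"
    using A by (intro lebesgue.emeasure_PiM) auto
  also have "\<dots> = (\<Prod>i<b. emeasure lborel (A i))"
    by (rule prod.reindex_bij_witness[of _ "\<lambda>i. i + a" "\<lambda>i. i - a"]) auto
  finally show "emeasure (distr ?P (PiM {..<b} (\<lambda>_. lborel)) (tail_coords a b)) (Pi\<^sub>E {..<b} A) = \<dots>" .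
qed auto

text \<open>Fubini for the disjoint index sets \<open>{..<a}\<close> and \<open>{a..<a + b}\<close>,
  followed by the index shift. It supplies the factorization hypotheses of
  \<open>density_channel_product\<close>.\<close>

lemma nn_integral_Rspace_split:
  fixes \<phi> \<psi> :: "(nat \<Rightarrow> real) \<Rightarrow> ennreal"
  assumes [measurable]: "\<phi> \<in> borel_measurable (Rspace a)" "\<psi> \<in> borel_measurable (Rspace b)"
  shows "(\<integral>\<^sup>+x. \<phi> (head_coords a x) * \<psi> (tail_coords a b x) \<partial>Rspace (a + b)) =
    (\<integral>\<^sup>+x. \<phi> x \<partial>Rspace a) * (\<integral>\<^sup>+x. \<psi> x \<partial>Rspace b)"
proof -
  let ?J = "{a..<a + b}"
  let ?P = "PiM ?J (\<lambda>_. lborel :: real measure)"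
  have un: "{..<a + b} = {..<a} \<union> ?J" by auto
  have m [measurable]: "tail_coords a b \<in> measurable ?P (Rspace b)"
    by (rule measurable_tail_coords_PiM)
  have "(\<lambda>x. \<phi> (head_coords a x) * \<psi> (tail_coords a b x)) \<in> borel_measurable (Rspace (a + b))"
    by measurable
  then have meas: "(\<lambda>x. \<phi> (head_coords a x) * \<psi> (tail_coords a b x)) \<in> borel_measurable (PiM ({..<a} \<union> ?J) (\<lambda>_. lborel))"
    by (simp add: Rspace_def un)
  have "(\<integral>\<^sup>+x. \<phi> (head_coords a x) * \<psi> (tail_coords a b x) \<partial>Rspace (a + b)) =
     (\<integral>\<^sup>+x. \<integral>\<^sup>+y. \<phi> (head_coords a (merge {..<a} ?J (x, y))) * \<psi> (tail_coords a b (merge {..<a} ?J (x, y))) \<partial>?P \<partial>Rspace a)"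
    unfolding Rspace_def[of "a + b"] Rspace_def[of a] un
    by (rule lebesgue.product_nn_integral_fold[OF _ _ _ meas]) auto
  also have "\<dots> = (\<integral>\<^sup>+x. \<integral>\<^sup>+y. \<phi> x * \<psi> (tail_coords a b y) \<partial>?P \<partial>Rspace a)"
  proof (intro nn_integral_cong arg_cong2[of _ _ _ _ "(*)"] arg_cong[of _ _ \<phi>] arg_cong[of _ _ \<psi>])
    \<comment> \<open>Points of \<open>Rspace a\<close> are extensional, so restricting the merged
      point to \<open>{..<a}\<close> returns \<open>x\<close> itself.\<close>
    fix x y assume "x \<in> space (Rspace a)"
    then show "head_coords a (merge {..<a} ?J (x, y)) = x"
      by (intro ext) (auto simp: head_coords_def merge_def Rspace_def space_PiM PiE_iff extensional_def)
    show "tail_coords a b (merge {..<a} ?J (x, y)) = tail_coords a b y"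
      by (intro ext) (auto simp: tail_coords_def merge_def)
  qed
  also have "\<dots> = (\<integral>\<^sup>+x. \<phi> x * (\<integral>\<^sup>+y. \<psi> (tail_coords a b y) \<partial>?P) \<partial>Rspace a)"
  proof (rule nn_integral_cong)
    show "(\<integral>\<^sup>+y. \<phi> x * \<psi> (tail_coords a b y) \<partial>?P) = \<phi> x * (\<integral>\<^sup>+y. \<psi> (tail_coords a b y) \<partial>?P)" for x
      by (rule nn_integral_cmult) measurable
  qed
  also have "(\<integral>\<^sup>+y. \<psi> (tail_coords a b y) \<partial>?P) = (\<integral>\<^sup>+y. \<psi> y \<partial>Rspace b)"
    using nn_integral_distr[OF m, of \<psi>] by (simp add: distr_tail_coords)
  finally show ?thesis by (simp add: nn_integral_multc)
qed

section \<open>Gaussian channels with block-diagonal covariance\<close>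

abbreviation block_sum :: "real mat \<Rightarrow> real mat \<Rightarrow> real mat" where
  "block_sum A B \<equiv> four_block_mat A (0\<^sub>m (dim_row A) (dim_col B)) (0\<^sub>m (dim_row B) (dim_col A)) B"

lemma quad_form_block_sum:
  assumes "A \<in> carrier_mat a a" "B \<in> carrier_mat b b"
  shows "quad_form (a + b) (block_sum A B) x = quad_form a A x + quad_form b B (\<lambda>i. x (a + i))"
  using assms by (simp add: quad_form_def sum_lessThan_add_split)

lemma pos_def_block_sum:
  assumes A: "pos_def a A" and B: "pos_def b B"
  shows "pos_def (a + b) (block_sum A B)"
proof -
  have AC: "A \<in> carrier_mat a a" and BC: "B \<in> carrier_mat b b" using A B by (auto simp: pos_def_def)
  show ?thesis
    unfolding pos_def_iff_quad_form quad_form_block_sum[OF AC BC]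
  proof (intro conjI allI impI)
    show "block_sum A B \<in> carrier_mat (a + b) (a + b)" using AC BC by (rule four_block_carrier_mat)
    show "block_sum A B $$ (i, j) = block_sum A B $$ (j, i)" if "i < a + b" "j < a + b" for i j
      using that AC BC pos_def_sym[OF A, of i j] pos_def_sym[OF B, of "i - a" "j - a"] by simp
    fix x :: "nat \<Rightarrow> real"
    assume "\<exists>i<a + b. x i \<noteq> 0"
    then obtain i where i: "i < a + b" "x i \<noteq> 0" by blast
    note nn = quad_form_nonneg[OF A, of x] quad_form_nonneg[OF B, of "\<lambda>i. x (a + i)"]
    show "0 < quad_form a A x + quad_form b B (\<lambda>i. x (a + i))"
    proof (cases "i < a")
      case True
      then have "0 < quad_form a A x" using i(2) by (rule quad_form_pos[OF A])
      then show ?thesis using nn by simp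
    next
      case False
      then have "a + (i - a) = i" "i - a < b" using i(1) by linarith+
      then have "0 < quad_form b B (\<lambda>i. x (a + i))" using i(2) by (intro quad_form_pos[OF B, of "i - a"]) auto
      then show ?thesis using nn by simp
    qed
  qed
qed

lemma mat_inv_block_sum:
  assumes A: "pos_def a A" and B: "pos_def b B"
  shows "mat_inv (block_sum A B) = block_sum (mat_inv A) (mat_inv B)"
proof (rule mat_inv_eqI)
  have AC: "A \<in> carrier_mat a a" and BC: "B \<in> carrier_mat b b" using A B by (auto simp: pos_def_def)
  note PA = mat_inv_pos_def[OF A] and PB = mat_inv_pos_def[OF B]
  show "block_sum A B \<in> carrier_mat (a + b) (a + b)" using AC BC by (rule four_block_carrier_mat)
  show "block_sum (mat_inv A) (mat_inv B) \<in> carrier_mat (a + b) (a + b)" using PA(1) PB(1) by (rule four_block_carrier_mat)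
  show "block_sum A B * block_sum (mat_inv A) (mat_inv B) = 1\<^sub>m (a + b)"
    using AC BC PA PB
    by (subst mult_four_block_mat[of _ a a _ b _ b _ _ a _ b]) auto
qed

lemma exp_neg_add_divide: "exp (- ((u + v) / c)) = exp (- (u / c)) * exp (- (v / c))" for u v c :: real
  by (simp add: exp_add[symmetric] add_divide_distrib)

lemma gauss_density_block_sum:
  assumes A: "pos_def a A" and B: "pos_def b B"
  shows "gauss_density (a + b) (0\<^sub>v (a + b)) (block_sum A B) x =
    gauss_density a (0\<^sub>v a) A (head_coords a x) * gauss_density b (0\<^sub>v b) B (tail_coords a b x)"
proof -
  have AC: "A \<in> carrier_mat a a" and BC: "B \<in> carrier_mat b b" using A B by (auto simp: pos_def_def)
  note PA = mat_inv_pos_def(1)[OF A] and PB = mat_inv_pos_def(1)[OF B]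
  have det: "det (block_sum A B) = det A * det B"
    using AC BC by (intro det_four_block_mat_lower_left_zero[of _ a _ b]) auto
  have "quad_form (a + b) (mat_inv (block_sum A B)) (\<lambda>i. x i - 0\<^sub>v (a + b) $ i) =
      quad_form (a + b) (mat_inv (block_sum A B)) x"
    by (intro quad_form_cong) simp
  also have "\<dots> = quad_form a (mat_inv A) x + quad_form b (mat_inv B) (\<lambda>i. x (a + i))"
    unfolding mat_inv_block_sum[OF A B] by (rule quad_form_block_sum[OF PA PB])
  also have "quad_form a (mat_inv A) x = quad_form a (mat_inv A) (\<lambda>i. head_coords a x i - 0\<^sub>v a $ i)"
    by (intro quad_form_cong) (simp add: head_coords_def)
  also have "quad_form b (mat_inv B) (\<lambda>i. x (a + i)) = quad_form b (mat_inv B) (\<lambda>i. tail_coords a b x i - 0\<^sub>v b $ i)"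
    by (intro quad_form_cong) (simp add: tail_coords_def)
  finally show ?thesis
    unfolding gauss_density_eq[OF A zero_carrier_vec] gauss_density_eq[OF B zero_carrier_vec]
      gauss_density_eq[OF pos_def_block_sum[OF A B] zero_carrier_vec] det
    by (simp add: exp_neg_add_divide real_sqrt_mult power_add mult_ac del: minus_add_distrib)
qed

lemma gauss_density_isotropic_split:
  assumes s2: "0 < s2" and mu: "mu \<in> carrier_vec (a + b)" and mu1: "mu1 \<in> carrier_vec a" and mu2: "mu2 \<in> carrier_vec b"
    and "\<And>i. i < a \<Longrightarrow> mu $ i = mu1 $ i" "\<And>i. i < b \<Longrightarrow> mu $ (a + i) = mu2 $ i"
  shows "gauss_density (a + b) mu (s2 \<cdot>\<^sub>m 1\<^sub>m (a + b)) z =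
    gauss_density a mu1 (s2 \<cdot>\<^sub>m 1\<^sub>m a) (head_coords a z) * gauss_density b mu2 (s2 \<cdot>\<^sub>m 1\<^sub>m b) (tail_coords a b z)"
proof -
  have "(\<Sum>i<a + b. (z i - mu $ i)\<^sup>2) =
      (\<Sum>i<a. (head_coords a z i - mu1 $ i)\<^sup>2) + (\<Sum>i<b. (tail_coords a b z i - mu2 $ i)\<^sup>2)"
    using assms(5,6) by (simp add: sum_lessThan_add_split head_coords_def tail_coords_def)
  then show ?thesis
    unfolding gauss_density_isotropic[OF s2 mu] gauss_density_isotropic[OF s2 mu1] gauss_density_isotropic[OF s2 mu2]
    by (simp add: exp_neg_add_divide real_sqrt_mult power_add mult_ac del: minus_add_distrib)
qed

text \<open>When each output block sees only its own input block, source and noise both factor and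
  the informations add. Integrability is also a conclusion, so that the lemma can be
  iterated.\<close>

lemma gauss_channel_block_sum:
  assumes "gauss_channel p1 q1 S1 s2 m1" "gauss_channel p2 q2 S2 s2 m2"
    and "gauss_channel (p1 + p2) (q1 + q2) (block_sum S1 S2) s2 m"
    and m1: "\<And>x i. i < q1 \<Longrightarrow> m (vec (p1 + p2) x) $ i = m1 (vec p1 (head_coords p1 x)) $ i"
    and m2: "\<And>x i. i < q2 \<Longrightarrow> m (vec (p1 + p2) x) $ (q1 + i) = m2 (vec p2 (tail_coords p1 p2 x)) $ i"
    and "gauss_channel.info_integrable p1 q1 S1 s2 m1" "gauss_channel.info_integrable p2 q2 S2 s2 m2"
  shows "gauss_channel.info_integrable (p1 + p2) (q1 + q2) (block_sum S1 S2) s2 m"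
    and "gauss_channel_MI (p1 + p2) (q1 + q2) (block_sum S1 S2) s2 m =
      gauss_channel_MI p1 q1 S1 s2 m1 + gauss_channel_MI p2 q2 S2 s2 m2"
proof -
  interpret C1: gauss_channel p1 q1 S1 s2 m1 by fact
  interpret C2: gauss_channel p2 q2 S2 s2 m2 by fact
  interpret C: gauss_channel "p1 + p2" "q1 + q2" "block_sum S1 S2" s2 m by fact
  have int1: "integrable C1.joint C1.info" and int2: "integrable C2.joint C2.info"
    using assms(6,7) by (simp_all add: C1.info_integrable_def C2.info_integrable_def)
  have src: "C.src x = C1.src (head_coords p1 x) * C2.src (tail_coords p1 p2 x)" for x
    by (rule gauss_density_block_sum[OF C1.S C2.S])
  have noise: "C.noise x z = C1.noise (head_coords p1 x) (head_coords q1 z) * C2.noise (tail_coords p1 p2 x) (tail_coords q1 q2 z)" for x z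
    by (intro gauss_density_isotropic_split C1.s2 C.m_carrier C1.m_carrier C2.m_carrier m1 m2)
  note * = density_channel_product[OF C.density_channel_axioms C1.density_channel_axioms C2.density_channel_axioms
    measurable_head_coords measurable_tail_coords measurable_head_coords measurable_tail_coords
    nn_integral_Rspace_split nn_integral_Rspace_split src noise int1 int2]
  show C.info_integrable unfolding C.info_integrable_def by (rule *(1))
  show "gauss_channel_MI (p1 + p2) (q1 + q2) (block_sum S1 S2) s2 m =
      gauss_channel_MI p1 q1 S1 s2 m1 + gauss_channel_MI p2 q2 S2 s2 m2"
    unfolding C.gauss_channel_MI_eq C1.gauss_channel_MI_eq C2.gauss_channel_MI_eq by (rule *(2))
qed

section \<open>The convolution channel as an iterated block sum\<close>

lemma div_mod_block: "i < NB \<Longrightarrow> (n * NB + i) div NB = n \<and> (n * NB + i) mod NB = i" for i NB n :: nat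
  by simp

lemma blockdiag_rep_Suc:
  assumes "S \<in> carrier_mat NB NB"
  shows "blockdiag_rep NB (Suc n) S = block_sum (blockdiag_rep NB n S) S"
proof (rule eq_matI)
  let ?R = "block_sum (blockdiag_rep NB n S) S"
  fix i j assume "i < dim_row ?R" "j < dim_col ?R"
  then have i: "i < n * NB + NB" and j: "j < n * NB + NB" using assms by (simp_all add: blockdiag_rep_def)
  have div_less: "k div NB < n" if "k < n * NB" for k using that by (simp add: less_mult_imp_div_less)
  have tail: "k div NB = n" "k mod NB = k - n * NB" if "\<not> k < n * NB" "k < n * NB + NB" for k
    using div_mod_block[of "k - n * NB" NB n] that by auto
  show "blockdiag_rep NB (Suc n) S $$ (i, j) = ?R $$ (i, j)"
    using i j assms div_less[of i] div_less[of j] tail[of i] tail[of j]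
    by (cases "i < n * NB"; cases "j < n * NB") (simp_all add: blockdiag_rep_def add.commute)
qed (use assms in \<open>auto simp: blockdiag_rep_def\<close>)

lemma pos_def_blockdiag_rep:
  assumes S: "pos_def NB S" shows "pos_def (n * NB) (blockdiag_rep NB n S)"
proof (induction n)
  case 0
  then show ?case by (simp add: pos_def_iff_quad_form blockdiag_rep_def)
next
  case (Suc n)
  have SC: "S \<in> carrier_mat NB NB" using S by (simp add: pos_def_def)
  show ?case
    using pos_def_block_sum[OF Suc.IH S] by (simp add: blockdiag_rep_Suc[OF SC] add.commute)
qed

lemma block_index_less:
  fixes i l n NB Nf :: nat
  assumes "i < n * Nf" "l < NB" shows "i div Nf * NB + l < n * NB"
proof -
  have "i div Nf < n" using assms(1) by (simp add: less_mult_imp_div_less)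
  then have "Suc (i div Nf) * NB \<le> n * NB" by (intro mult_le_mono1) simp
  then show ?thesis using assms(2) by simp
qed

lemma conv_stride_index:
  assumes W: "W \<in> carrier_mat Nf NB" and Nf: "0 < Nf" and i: "i < n * Nf"
  shows "conv_stride NB Nf n (vec (n * NB) x) W $ i = (\<Sum>l<NB. W $$ (i mod Nf, l) * x ((i div Nf) * NB + l))"
proof -
  have "i div Nf * NB + l < n * NB" if "l < NB" for l by (rule block_index_less[OF i that])
  then show ?thesis
    using W Nf i by (simp add: conv_stride_def slice_def scalar_prod_def lessThan_atLeast0)
qed

locale conv_gauss_channel =
  fixes NB Nf :: nat and S :: "real mat" and s2 :: real and W :: "real mat"
  assumes S: "pos_def NB S" and s2: "0 < s2" and W: "W \<in> carrier_mat Nf NB" and Nf: "0 < Nf"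
begin

text \<open>The block count and the bias are arguments and not locale parameters, because the
  induction on the number of blocks changes both.\<close>

definition "conv_map n b x = conv_stride NB Nf n x W + b"

lemma conv_map_index:
  "b \<in> carrier_vec (n * Nf) \<Longrightarrow> i < n * Nf \<Longrightarrow> conv_map n b (vec (n * NB) x) $ i =
    (\<Sum>l<NB. W $$ (i mod Nf, l) * x ((i div Nf) * NB + l)) + b $ i"
  by (simp add: conv_map_def conv_stride_index[OF W Nf])

lemma gauss_channel_conv:
  assumes b: "b \<in> carrier_vec (n * Nf)"
  shows "gauss_channel (n * NB) (n * Nf) (blockdiag_rep NB n S) s2 (conv_map n b)"
proof
  show "pos_def (n * NB) (blockdiag_rep NB n S)" by (rule pos_def_blockdiag_rep[OF S])
  show "0 < s2" by (rule s2)
  show "conv_map n b (vec (n * NB) x) \<in> carrier_vec (n * Nf)" for x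
    using b by (simp add: conv_map_def conv_stride_def)
  show "(\<lambda>x. conv_map n b (vec (n * NB) x) $ i) \<in> borel_measurable (Rspace (n * NB))" if i: "i < n * Nf" for i
  proof -
    have [measurable]: "(\<lambda>x. x ((i div Nf) * NB + l)) \<in> borel_measurable (Rspace (n * NB))" if "l \<in> {..<NB}" for l
      using that by (intro measurable_Rspace_component block_index_less i) simp
    show ?thesis unfolding conv_map_index[OF b i] by measurable
  qed
qed

abbreviation "affine_MI b \<equiv> gauss_channel_MI NB Nf S s2 (\<lambda>x. W *\<^sub>v x + b)"

text \<open>Induction on the number of blocks, splitting off the last one as a fully connected
  channel with the same \<open>W\<close> and its own slice of the bias.\<close>

lemma conv_MI:
  assumes "b \<in> carrier_vec (n * Nf)"
  shows "gauss_channel.info_integrable (n * NB) (n * Nf) (blockdiag_rep NB n S) s2 (conv_map n b) \<and>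
    gauss_channel_MI (n * NB) (n * Nf) (blockdiag_rep NB n S) s2 (conv_map n b) =
    (\<Sum>j<n. affine_MI (vec Nf (\<lambda>i. b $ (j * Nf + i))))"
  using assms
proof (induction n arbitrary: b)
  case 0
  interpret C: gauss_channel 0 0 "blockdiag_rep NB 0 S" s2 "conv_map 0 b"
    using gauss_channel_conv[OF 0] by simp
  \<comment> \<open>Without blocks both spaces are single points: the noise density is 1, hence so
    is the output density, and the information density is 0.\<close>
  have one: "C.noise x z = 1" for x z
    using gauss_density_isotropic[OF s2 C.m_carrier[of x]] by simp
  have out: "z \<in> space (Rspace 0) \<Longrightarrow> C.out z = 1" for z
    using C.nn_integral_out[of z] C.nn_integral_f C.out_pos[of z] unfolding one by (simp add: one)
  have "C.info y = 0" if y_mem: "y \<in> space C.joint" for y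
  proof -
    obtain x z where y: "y = (x, z)" "z \<in> space (Rspace 0)" using y_mem unfolding C.space_joint by auto
    have ratio: "C.noise x z / C.out z = 1 / 1" by (intro arg_cong2[of _ _ _ _ "(/)"] one out y)
    show ?thesis unfolding y(1) C.info_def prod.case ratio by simp
  qed
  then have "integrable C.joint C.info \<and> (\<integral>y. C.info y \<partial>C.joint) = 0"
    by (auto cong: Bochner_Integration.integrable_cong Bochner_Integration.integral_cong)
  then show ?case by (simp add: C.info_integrable_def C.gauss_channel_MI_eq)
next
  case (Suc n)
  let ?b1 = "vec (n * Nf) (\<lambda>i. b $ i)" and ?b2 = "vec Nf (\<lambda>i. b $ (n * Nf + i))"
  have SC: "S \<in> carrier_mat NB NB" using S by (simp add: pos_def_def)
  have p: "Suc n * NB = n * NB + NB" and q: "Suc n * Nf = n * Nf + Nf" by simp_all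
  interpret L: affine_gauss_channel NB Nf S s2 W ?b2
    by standard (use S s2 W in auto)
  have L_m: "L.m = (\<lambda>x. W *\<^sub>v x + ?b2)" by (simp add: L.m_def fun_eq_iff)
  have c: "gauss_channel (n * NB + NB) (n * Nf + Nf) (block_sum (blockdiag_rep NB n S) S) s2 (conv_map (Suc n) b)"
    using gauss_channel_conv[OF Suc.prems] by (simp only: p q blockdiag_rep_Suc[OF SC])
  have head: "conv_map (Suc n) b (vec (n * NB + NB) x) $ i = conv_map n ?b1 (vec (n * NB) (head_coords (n * NB) x)) $ i"
    if i: "i < n * Nf" for x i
  proof -
    have "i div Nf * NB + l < n * NB" if "l < NB" for l by (rule block_index_less[OF i that])
    then show ?thesis
      unfolding p[symmetric] using i Suc.prems
      by (subst conv_map_index, simp, simp, subst conv_map_index) (auto simp: head_coords_def)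
  qed
  have tail: "conv_map (Suc n) b (vec (n * NB + NB) x) $ (n * Nf + i) = L.m (vec NB (tail_coords (n * NB) NB x)) $ i"
    if i: "i < Nf" for x i
    unfolding p[symmetric] using i Suc.prems div_mod_block[OF i, of n]
    by (subst conv_map_index) (auto simp: tail_coords_def L.m_index)
  have int: "L.info_integrable" by (simp add: L.info_integrable_def L.integrable_info)
  have b1: "?b1 \<in> carrier_vec (n * Nf)" by simp
  note IH = Suc.IH[OF b1]
  \<comment> \<open>Truncating the bias leaves its first \<open>n\<close> slices unchanged, since
    \<open>j < n\<close> keeps their indices below \<open>n * Nf\<close>.\<close>
  have b1_sum: "(\<Sum>j<n. affine_MI (vec Nf (\<lambda>i. ?b1 $ (j * Nf + i)))) = (\<Sum>j<n. affine_MI (vec Nf (\<lambda>i. b $ (j * Nf + i))))"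
  proof (intro sum.cong refl arg_cong[of _ _ affine_MI] eq_vecI)
    fix j i assume "j \<in> {..<n}" and i: "i < dim_vec (vec Nf (\<lambda>i. b $ (j * Nf + i)))"
    then have "Suc j * Nf \<le> n * Nf" by (intro mult_le_mono1) simp
    then show "vec Nf (\<lambda>i. ?b1 $ (j * Nf + i)) $ i = vec Nf (\<lambda>i. b $ (j * Nf + i)) $ i"
      using i by simp
  qed simp
  show ?case
    using gauss_channel_block_sum[OF gauss_channel_conv[OF b1] L.gauss_channel_axioms c head tail _ int] IH
    by (simp add: p q blockdiag_rep_Suc[OF SC] b1_sum L_m del: mult_Suc)
qed

end

section \<open>Comparison of the two suprema\<close>

theorem theorem3:
  fixes N0 NB Nf :: nat and St :: "real mat" and sigma2 F :: real
  assumes "N0 \<ge> 1" and "NB \<ge> 1" and "Nf \<ge> 1" and "NB dvd N0"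
    and "pos_def NB St"
    and "sigma2 > 0" and "F > 0"
  shows "MMI_conv N0 NB Nf St sigma2 F = real (N0 div NB) * M_LFC sigma2 F St NB Nf"
proof -
  define n where "n = N0 div NB"
  have N0: "N0 = n * NB" and n: "0 < n"
    using assms(1,2,4) by (auto simp: n_def dvd_div_mult_self div_greater_zero_iff dvd_imp_le)
  define LFC where "LFC = {gauss_channel_MI NB Nf St sigma2 (\<lambda>x. W *\<^sub>v x + b) | W b.
    W \<in> carrier_mat Nf NB \<and> b \<in> carrier_vec Nf \<and> mat_trace (W\<^sup>T * W) \<le> F}"
  define CONV where "CONV = {gauss_channel_MI N0 (n * Nf) (blockdiag_rep NB n St) sigma2 (\<lambda>x. conv_stride NB Nf n x W + b) | W b.
    W \<in> carrier_mat Nf NB \<and> b \<in> carrier_vec (n * Nf) \<and> mat_trace (W\<^sup>T * W) \<le> F}"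
  have conv: "gauss_channel_MI N0 (n * Nf) (blockdiag_rep NB n St) sigma2 (\<lambda>x. conv_stride NB Nf n x W + b) =
      (\<Sum>j<n. gauss_channel_MI NB Nf St sigma2 (\<lambda>x. W *\<^sub>v x + vec Nf (\<lambda>i. b $ (j * Nf + i))))"
    if "W \<in> carrier_mat Nf NB" "b \<in> carrier_vec (n * Nf)" for W b
  proof -
    interpret conv_gauss_channel NB Nf St sigma2 W
      by standard (use assms that in auto)
    show ?thesis using conv_MI[OF that(2)] by (simp add: N0 conv_map_def[abs_def])
  qed
  \<comment> \<open>Zero weights are admissible, so the set of fully connected informations is
    nonempty.\<close>
  have "mat_trace ((0\<^sub>m Nf NB)\<^sup>T * 0\<^sub>m Nf NB) \<le> F"
    using assms(7) by (simp add: mat_trace_def)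
  then have "gauss_channel_MI NB Nf St sigma2 (\<lambda>x. 0\<^sub>m Nf NB *\<^sub>v x + 0\<^sub>v Nf) \<in> LFC"
    unfolding LFC_def mem_Collect_eq
    by (intro exI[of _ "0\<^sub>m Nf NB"] exI[of _ "0\<^sub>v Nf"] conjI refl zero_carrier_mat zero_carrier_vec)
  then have LFC_ne: "LFC \<noteq> {}" by auto
  have LFC_bdd: "bdd_above LFC"
  proof (rule bdd_aboveI)
    fix y assume "y \<in> LFC"
    then obtain W b where y: "y = gauss_channel_MI NB Nf St sigma2 (\<lambda>x. W *\<^sub>v x + b)"
      and w: "W \<in> carrier_mat Nf NB" "b \<in> carrier_vec Nf" "mat_trace (W\<^sup>T * W) \<le> F"
      unfolding LFC_def by auto
    interpret affine_gauss_channel NB Nf St sigma2 W b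
      by standard (use assms w in auto)
    show "y \<le> max 0 (src_bound NB Nf St sigma2 F)"
      using gauss_channel_MI_le[OF w(3)] assms(7) by (simp add: y m_def[abs_def])
  qed
  \<comment> \<open>Every summand is the information of an admissible fully connected channel: same
    weights, one slice of the bias.\<close>
  have CONV_le: "y \<le> n * Sup LFC" if "y \<in> CONV" for y
  proof -
    from that obtain W b where y: "y = gauss_channel_MI N0 (n * Nf) (blockdiag_rep NB n St) sigma2 (\<lambda>x. conv_stride NB Nf n x W + b)"
      and w: "W \<in> carrier_mat Nf NB" "b \<in> carrier_vec (n * Nf)" "mat_trace (W\<^sup>T * W) \<le> F"
      unfolding CONV_def by auto
    have "y \<le> (\<Sum>j<n. Sup LFC)"
      unfolding y conv[OF w(1,2)]
    proof (intro sum_mono cSup_upper[OF _ LFC_bdd])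
      fix j
      show "gauss_channel_MI NB Nf St sigma2 (\<lambda>x. W *\<^sub>v x + vec Nf (\<lambda>i. b $ (j * Nf + i))) \<in> LFC"
        unfolding LFC_def mem_Collect_eq
        by (intro exI[of _ W] exI[of _ "vec Nf (\<lambda>i. b $ (j * Nf + i))"] conjI refl w vec_carrier)
    qed
    then show ?thesis by simp
  qed
  have LFC_CONV: "real n * y \<in> CONV" if "y \<in> LFC" for y
  proof -
    from that obtain W b where y: "y = gauss_channel_MI NB Nf St sigma2 (\<lambda>x. W *\<^sub>v x + b)"
      and w: "W \<in> carrier_mat Nf NB" "b \<in> carrier_vec Nf" "mat_trace (W\<^sup>T * W) \<le> F"
      unfolding LFC_def by auto
    \<comment> \<open>The bias \<open>b\<close> repeated \<open>n\<close> times, so that all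
      summands equal \<open>y\<close>.\<close>
    define b' where "b' = vec (n * Nf) (\<lambda>i. b $ (i mod Nf))"
    have b': "b' \<in> carrier_vec (n * Nf)" by (simp add: b'_def)
    have "vec Nf (\<lambda>i. b' $ (j * Nf + i)) = b" if "j < n" for j
    proof (rule eq_vecI)
      fix i assume "i < dim_vec b"
      then have i: "i < Nf" using w by simp
      have "Suc j * Nf \<le> n * Nf" using that by (intro mult_le_mono1) simp
      then show "vec Nf (\<lambda>i. b' $ (j * Nf + i)) $ i = b $ i" using i by (simp add: b'_def)
    qed (use w in simp)
    then have "real n * y = gauss_channel_MI N0 (n * Nf) (blockdiag_rep NB n St) sigma2 (\<lambda>x. conv_stride NB Nf n x W + b')"
      unfolding conv[OF w(1) b'] by (simp add: y)
    then show ?thesis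
      unfolding CONV_def mem_Collect_eq by (intro exI[of _ W] exI[of _ b'] conjI w b')
  qed
  have "Sup CONV \<le> n * Sup LFC"
    using LFC_ne LFC_CONV by (intro cSup_least CONV_le) auto
  moreover have "n * Sup LFC \<le> Sup CONV"
  proof -
    \<comment> \<open>Dividing by the positive \<open>n\<close> turns the claim into an upper bound
      for the elements of \<open>LFC\<close>; \<open>CONV_le\<close> supplies the boundedness of
      \<open>CONV\<close>.\<close>
    have "Sup LFC \<le> Sup CONV / n"
    proof (rule cSup_least[OF LFC_ne])
      fix y assume "y \<in> LFC"
      then have "real n * y \<le> Sup CONV"
        by (intro cSup_upper LFC_CONV bdd_aboveI[of _ "n * Sup LFC"] CONV_le)
      then show "y \<le> Sup CONV / n" using n by (simp add: field_simps)
    qed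
    then show ?thesis using n by (simp add: field_simps)
  qed
  ultimately have "Sup CONV = n * Sup LFC" by simp
  then show ?thesis
    by (simp add: MMI_conv_def M_LFC_def Let_def n_def[symmetric] CONV_def LFC_def)
qed

end
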